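(* Let $m,m'\ge 0$ and let ${\sf H}_{m,m'}:\mathcal A_{m,m'}\to\mathcal H_{m,m'}$ be the projector onto the first summand along the second in the direct sum decomposition $\mathcal A_{m,m'}=\mathcal H_{m,m'}\oplus Q\mathcal A_{m-1,m'-1}$. Then for all $p\in\mathcal A_{m,m'}$ $${\sf H}_{m,m'}\,p=\sum_{k=0}^{\min(m,m')}\alpha_k\,Q^k\Delta_q^k\,p,\qquad \alpha_k=(-1)^kq^{-(n-1)k}\frac{[m+m'+n-k-2]!}{[k]!\,[m+m'+n-2]!}.$$
   Context: Fix an integer $n\ge 1$ and a nonzero complex number $q$ that is not a root of unity. Put $[a]=(q^a-q^{-a})/(q-q^{-1})$, $[s]!=[s][s-1]\cdots[1]$, $[0]!=1$; the quotient $[N-k]!/[N]!$ is understood as $1/([N][N-1]\cdots[N-k+1])$ (equal to $1$ for $k=0$). $\mathcal A$ is the unital associative $\mathbb C$-algebra generated by $z_1,\dots,z_n,w_1,\dots,w_n$ with relations $z_iz_j=qz_jz_i$ and $w_iw_j=q^{-1}w_jw_i$ for $i<j$; $w_jz_i=qz_iw_j$ for $i\ne j$; $w_kz_k=z_kw_k+(1-q^2)\sum_{s<k}z_sw_s$. Both the monomials $z_1^{r_1}\cdots z_n^{r_n}w_1^{s_1}\cdots w_n^{s_n}$ and the monomials $w_1^{r_1}\cdots w_n^{r_n}z_1^{s_1}\cdots z_n^{s_n}$ form bases of $\mathcal A$. $\mathcal A_{m,m'}$ is the subspace of polynomials homogeneous of degree $m$ in the $z_i$ and of degree $m'$ in the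 $w_i$ ($\mathcal A_{m,m'}=0$ if $m<0$ or $m'<0$). Linear operators $\partial_i,\bar\partial_i$ on $\mathcal A$ are defined on these bases by $\partial_i(z_1^{r_1}\cdots z_n^{r_n}w_1^{s_1}\cdots w_n^{s_n})=q^{r_{i+1}+\cdots+r_n}[r_i]\,z_1^{r_1}\cdots z_i^{r_i-1}\cdots z_n^{r_n}w_1^{s_1}\cdots w_n^{s_n}$ and $\bar\partial_i(w_1^{r_1}\cdots w_n^{r_n}z_1^{s_1}\cdots z_n^{s_n})=q^{-(r_{i+1}+\cdots+r_n)}[r_i]\,w_1^{r_1}\cdots w_i^{r_i-1}\cdots w_n^{r_n}z_1^{s_1}\cdots z_n^{s_n}$ (both are $0$ if $r_i=0$). The $q$-Laplace operator is $\Delta_q=\sum_{i=1}^n\partial_i\bar\partial_i$ $(=\sum_{i=1}^n q^{2(i-1)}\bar\partial_i\partial_i)$; it maps $\mathcal A_{m,m'}$ to $\mathcal A_{m-1,m'-1}$. $Q=\sum_{i=1}^n z_iw_i$, a central element of $\mathcal A$. $\mathcal H=\{p\in\mathcal A:\Delta_qp=0\}$ is the space of $q$-harmonic polynomials and $\mathcal H_{m,m'}=\mathcal A_{m,m'}\cap\mathcal H$. *)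

theory Defs
  imports Complex_Main "HOL-Library.Poly_Mapping" "HOL-Library.Cardinality"
begin

text \<open>The index set \<open>{1, \<dots>, n}\<close> is a finite linearly ordered type \<open>'n\<close>, so that
  \<open>n = CARD('n) \<ge> 1\<close>.\<close>

datatype 'n gen = Z 'n | W 'n

datatype 'n word = Word (letters: "'n gen list")

instantiation word :: (type) monoid_add
begin

definition "0 = Word []"

definition "u + v = Word (letters u @ letters v)"

instance
  by standard (simp_all add: zero_word_def plus_word_def)

end

text \<open>The free algebra is the monoid algebra of the free monoid; its product is the convolution
  product of \<^theory>\<open>HOL-Library.Poly_Mapping\<close> over concatenation of words.\<close>

type_synonym 'n free_alg = "'n word \<Rightarrow>\<^sub>0 complex"

definition const :: "complex \<Rightarrow> 'n free_alg" where
  "const c = Poly_Mapping.single 0 c"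

definition letter :: "'n gen \<Rightarrow> 'n free_alg" where
  "letter g = Poly_Mapping.single (Word [g]) 1"

abbreviation "fz i \<equiv> letter (Z i)"
abbreviation "fw i \<equiv> letter (W i)"

definition relators :: "complex \<Rightarrow> ('n :: {finite, linorder}) free_alg set" where
  "relators q =
     {fz i * fz j - const q * fz j * fz i | i j. i < j}
   \<union> {fw i * fw j - const (inverse q) * fw j * fw i | i j. i < j}
   \<union> {fw j * fz i - const q * fz i * fw j | i j. i \<noteq> j}
   \<union> {fw k * fz k - (fz k * fw k + const (1 - q\<^sup>2) * (\<Sum>s | s < k. fz s * fw s)) | k. True}"

inductive_set two_sided_ideal :: "'r :: ring_1 set \<Rightarrow> 'r set" for R where
  base: "r \<in> R \<Longrightarrow> r \<in> two_sided_ideal R"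
| zero: "0 \<in> two_sided_ideal R"
| add: "x \<in> two_sided_ideal R \<Longrightarrow> y \<in> two_sided_ideal R \<Longrightarrow> x + y \<in> two_sided_ideal R"
| left: "x \<in> two_sided_ideal R \<Longrightarrow> a * x \<in> two_sided_ideal R"
| right: "x \<in> two_sided_ideal R \<Longrightarrow> x * a \<in> two_sided_ideal R"

text \<open>The algebra \<open>\<A>\<close> is given by its quotient map: \<open>\<pi>\<close> is a surjective homomorphism from the free
  algebra onto the ring \<open>'a\<close> whose kernel is exactly the ideal generated by the relators. The
  complex scalars act on \<open>'a\<close> through \<open>\<pi>\<close>.\<close>

definition presents_algebra ::
    "complex \<Rightarrow> (('n :: {finite, linorder}) free_alg \<Rightarrow> 'a :: ring_1) \<Rightarrow> bool" where
  "presents_algebra q \<pi> \<longleftrightarrow>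
     (\<forall>x y. \<pi> (x + y) = \<pi> x + \<pi> y) \<and> (\<forall>x y. \<pi> (x * y) = \<pi> x * \<pi> y) \<and> \<pi> 1 = 1
   \<and> surj \<pi> \<and> {x. \<pi> x = 0} = two_sided_ideal (relators q)"

definition scal :: "('n free_alg \<Rightarrow> 'a :: ring_1) \<Rightarrow> complex \<Rightarrow> 'a \<Rightarrow> 'a" where
  "scal \<pi> c x = \<pi> (const c) * x"

text \<open>Bidegrees are integers, so that the component is \<open>0\<close> when one of them is negative.\<close>

definition zdeg :: "'n word \<Rightarrow> nat" where
  "zdeg u = length (filter (\<lambda>g. \<exists>i. g = Z i) (letters u))"

definition wdeg :: "'n word \<Rightarrow> nat" where
  "wdeg u = length (filter (\<lambda>g. \<exists>i. g = W i) (letters u))"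

definition homog :: "('n free_alg \<Rightarrow> 'a :: ring_1) \<Rightarrow> int \<Rightarrow> int \<Rightarrow> 'a set" where
  "homog \<pi> m m' = \<pi> ` {p. \<forall>u \<in> Poly_Mapping.keys p. int (zdeg u) = m \<and> int (wdeg u) = m'}"

definition zmon :: "(('n :: {finite, linorder}) free_alg \<Rightarrow> 'a :: ring_1) \<Rightarrow> ('n \<Rightarrow> nat) \<Rightarrow> 'a" where
  "zmon \<pi> r = prod_list (map (\<lambda>i. \<pi> (fz i) ^ r i) (sorted_list_of_set UNIV))"

definition wmon :: "(('n :: {finite, linorder}) free_alg \<Rightarrow> 'a :: ring_1) \<Rightarrow> ('n \<Rightarrow> nat) \<Rightarrow> 'a" where
  "wmon \<pi> r = prod_list (map (\<lambda>i. \<pi> (fw i) ^ r i) (sorted_list_of_set UNIV))"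

definition qnum :: "complex \<Rightarrow> int \<Rightarrow> complex" where
  "qnum q a = (q powi a - q powi (- a)) / (q - inverse q)"

definition qfact :: "complex \<Rightarrow> nat \<Rightarrow> complex" where
  "qfact q s = (\<Prod>j=1..s. qnum q (int j))"

text \<open>\<open>[N - k]! / [N]!\<close>, read as \<open>1 / ([N] [N - 1] \<cdots> [N - k + 1])\<close>; here \<open>N\<close> may be \<open>-1\<close>.\<close>

definition qfact_quot :: "complex \<Rightarrow> int \<Rightarrow> nat \<Rightarrow> complex" where
  "qfact_quot q N k = 1 / (\<Prod>j<k. qnum q (N - int j))"

text \<open>The linear operators \<open>\<partial>\<^sub>i\<close> and their conjugates, through their values on the two monomial
  bases. For \<open>r i = 0\<close> the value is \<open>0\<close> because \<open>[0] = 0\<close>; the truncated exponent is then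
  irrelevant.\<close>

definition q_partials :: "complex \<Rightarrow> (('n :: {finite, linorder}) free_alg \<Rightarrow> 'a :: ring_1)
    \<Rightarrow> ('n \<Rightarrow> 'a \<Rightarrow> 'a) \<Rightarrow> bool" where
  "q_partials q \<pi> D \<longleftrightarrow> (\<forall>i. Vector_Spaces.linear (scal \<pi>) (scal \<pi>) (D i) \<and>
     (\<forall>r s. D i (zmon \<pi> r * wmon \<pi> s) =
        scal \<pi> (q ^ (\<Sum>j | i < j. r j) * qnum q (int (r i)))
          (zmon \<pi> (r(i := r i - 1)) * wmon \<pi> s)))"

definition q_conj_partials :: "complex \<Rightarrow> (('n :: {finite, linorder}) free_alg \<Rightarrow> 'a :: ring_1)
    \<Rightarrow> ('n \<Rightarrow> 'a \<Rightarrow> 'a) \<Rightarrow> bool" where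
  "q_conj_partials q \<pi> D \<longleftrightarrow> (\<forall>i. Vector_Spaces.linear (scal \<pi>) (scal \<pi>) (D i) \<and>
     (\<forall>r s. D i (wmon \<pi> r * zmon \<pi> s) =
        scal \<pi> (q powi (- int (\<Sum>j | i < j. r j)) * qnum q (int (r i)))
          (wmon \<pi> (r(i := r i - 1)) * zmon \<pi> s)))"

definition q_laplace :: "('n :: finite \<Rightarrow> 'a \<Rightarrow> 'a) \<Rightarrow> ('n \<Rightarrow> 'a \<Rightarrow> 'a) \<Rightarrow> 'a \<Rightarrow> 'a :: ring_1" where
  "q_laplace D D' p = (\<Sum>i\<in>UNIV. D i (D' i p))"

definition Qelt :: "(('n :: finite) free_alg \<Rightarrow> 'a :: ring_1) \<Rightarrow> 'a" where
  "Qelt \<pi> = (\<Sum>i\<in>UNIV. \<pi> (fz i) * \<pi> (fw i))"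

definition harmonic :: "('a \<Rightarrow> 'a :: ring_1) \<Rightarrow> 'a set" where
  "harmonic \<Delta> = {p. \<Delta> p = 0}"

definition harmonic_homog :: "('n free_alg \<Rightarrow> 'a :: ring_1) \<Rightarrow> ('a \<Rightarrow> 'a) \<Rightarrow> int \<Rightarrow> int \<Rightarrow> 'a set" where
  "harmonic_homog \<pi> \<Delta> m m' = homog \<pi> m m' \<inter> harmonic \<Delta>"

definition Q_homog :: "(('n :: finite) free_alg \<Rightarrow> 'a :: ring_1) \<Rightarrow> int \<Rightarrow> int \<Rightarrow> 'a set" where
  "Q_homog \<pi> m m' = {Qelt \<pi> * x | x. x \<in> homog \<pi> (m - 1) (m' - 1)}"

definition direct_sum :: "'a :: ring_1 set \<Rightarrow> 'a set \<Rightarrow> 'a set \<Rightarrow> bool" where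
  "direct_sum X U V \<longleftrightarrow> X = {u + v | u v. u \<in> U \<and> v \<in> V} \<and> U \<inter> V = {0}"

definition projector :: "'a :: ring_1 set \<Rightarrow> 'a set \<Rightarrow> 'a \<Rightarrow> 'a" where
  "projector U V p = (THE u. u \<in> U \<and> (\<exists>v\<in>V. p = u + v))"

definition alpha :: "complex \<Rightarrow> nat \<Rightarrow> nat \<Rightarrow> nat \<Rightarrow> nat \<Rightarrow> complex" where
  "alpha q n m m' k = (-1) ^ k * q powi (- ((int n - 1) * int k))
     * (qfact_quot q (int m + int m' + int n - 2) k / qfact q k)"

end

theory Submission
  imports Defs
begin

text \<open>Everything rests on the commutation rule \<open>\<Delta> (Q x) = Q \<Delta> x + q ^ (n - 1) [m + m' + n] x\<close> for
  \<open>x\<close> of bidegree \<open>(m, m')\<close>: iterating it makes \<open>\<Delta> (\<Sum>\<alpha>\<^sub>k Q\<^sup>k \<Delta>\<^sup>k p)\<close> and \<open>\<Sum>\<alpha>\<^sub>k Q\<^sup>k \<Delta>\<^sup>k (Q x)\<close>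
  telescope to \<open>0\<close>, which gives both the direct sum and the projector. With \<open>\<delta>\<^sub>i\<close> the conjugate of
  \<open>\<partial>\<^sub>i\<close>, the rule follows from \<open>\<partial>\<^sub>i (Q x) = q Q \<partial>\<^sub>i x + q ^ (-m) w\<^sub>i x\<close>, its conjugate, and the Euler
  identities for \<open>\<Sum>w\<^sub>i \<delta>\<^sub>i x\<close> and \<open>\<Sum>q ^ (2 (n - i)) \<partial>\<^sub>i (z\<^sub>i x)\<close>. Conjugate statements come for free:
  the substitution \<open>(z\<^sub>i, w\<^sub>i, q) \<mapsto> (w\<^sub>i, q ^ (2 (n - i)) z\<^sub>i, 1 / q)\<close> preserves the defining relations
  and fixes \<open>Q\<close>, so one abstract calculus is interpreted twice.\<close>

section \<open>q-derivations\<close>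

lemma qnum_of_nat: "qnum p (int r) = (p ^ r - inverse p ^ r) / (p - inverse p)"
  by (simp add: qnum_def power_int_minus power_inverse)

lemma qnum_0 [simp]: "qnum p 0 = 0"
  by (simp add: qnum_def)

lemma qnum_Suc:
  assumes "p \<noteq> 0" "p\<^sup>2 \<noteq> 1"
  shows "qnum p (int (Suc r)) = inverse p * qnum p (int r) + p ^ r"
proof -
  have "p - inverse p \<noteq> 0"
    using assms by (auto simp: power2_eq_square field_simps)
  then show ?thesis
    unfolding qnum_of_nat by (simp add: divide_simps) (simp add: algebra_simps assms)
qed

text \<open>The scalar identity behind \<open>sum_D_a_mult\<close>; the quotient is the geometric
  series of the weights. With \<open>M = p ^ m\<close> and \<open>N = p ^ n\<close> it becomes an
  identity of rational functions in \<open>p\<close>, \<open>M\<close>, \<open>N\<close>.\<close>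

lemma qnum_add_geometric:
  assumes "p \<noteq> 0" "p\<^sup>2 \<noteq> 1"
  shows "((p\<^sup>2) ^ Suc n - 1) / (p\<^sup>2 - 1) * p ^ m + inverse p * qnum p (int m) =
    p ^ (Suc n - 1) * qnum p (int (m + Suc n))"
proof -
  define d where "d = p\<^sup>2 - 1"
  have d: "d \<noteq> 0" "p - inverse p = d / p"
    using assms by (simp_all add: d_def power2_eq_square field_simps)
  define M N where "M = p ^ m" and "N = p ^ n"
  have MN: "M \<noteq> 0" "N \<noteq> 0"
    using assms by (simp_all add: M_def N_def)
  have "(p\<^sup>2 * N\<^sup>2 - 1) / d * M + inverse p * ((M - inverse M) / (d / p)) =
      N * ((M * (p * N) - inverse (M * (p * N))) / (d / p))"
    using d MN assms by (simp add: field_simps power2_eq_square)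
  then show ?thesis
    unfolding qnum_of_nat d(2)
    by (simp add: M_def N_def d_def power_add power_inverse power_mult[symmetric] mult.commute)
qed

section \<open>Telescoping and geometric sums over finite linear orders\<close>

text \<open>Adding a new maximum \<open>b\<close> leaves the earlier terms unchanged and contributes
  \<open>G A - G (insert b A)\<close>.\<close>

lemma sum_telescope_linorder:
  fixes G :: "'n::linorder set \<Rightarrow> 'b::ab_group_add"
  assumes "finite S"
  shows "(\<Sum>j\<in>S. G {k\<in>S. k < j} - G {k\<in>S. k \<le> j}) = G {} - G S"
  using assms
proof (induction S rule: finite_linorder_max_induct)
  case (insert b A)
  have "{k \<in> insert b A. k < j} = {k \<in> A. k < j}" "{k \<in> insert b A. k \<le> j} = {k \<in> A. k \<le> j}"
    if "j \<in> A" for j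
    using insert.hyps that by (auto dest: order.strict_trans1 less_imp_not_less)
  moreover have "{k \<in> insert b A. k < b} = A" "{k \<in> insert b A. k \<le> b} = insert b A"
    using insert.hyps by force+
  moreover have "b \<notin> A"
    using insert.hyps by auto
  ultimately show ?case
    using insert by simp
qed simp

text \<open>The exponents run through 0, ..., \<open>card S - 1\<close>: a new minimum has all of
  \<open>A\<close> above it and contributes \<open>x ^ card A\<close>.\<close>

lemma geometric_sum_linorder:
  fixes x :: "'b::comm_ring_1" and S :: "'n::linorder set"
  assumes "finite S"
  shows "(x - 1) * (\<Sum>i\<in>S. x ^ card {k\<in>S. i < k}) = x ^ card S - 1"
  using assms
proof (induction S rule: finite_linorder_min_induct)
  case (insert b A)
  have "{k \<in> insert b A. j < k} = {k \<in> A. j < k}" if "j \<in> A" for j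
    using insert.hyps that by (auto dest: less_imp_not_less)
  moreover have "{k \<in> insert b A. b < k} = A"
    using insert.hyps by force
  moreover have "b \<notin> A"
    using insert.hyps by auto
  ultimately show ?case
    using insert by (simp add: algebra_simps)
qed simp

section \<open>Complex algebras and graded spans\<close>

locale complex_algebra = vector_space scale
  for scale :: "complex \<Rightarrow> 'a :: ring_1 \<Rightarrow> 'a" (infixr "*s" 75) +
  assumes scale_mult_left: "(c *s x) * y = c *s (x * y)"
    and mult_scale_right: "x * (c *s y) = c *s (x * y)"
begin

text \<open>The part of degree \<open>k\<close> in the \<open>a i\<close> over \<open>U\<close>.
  Letters are put on the left only, so that inductions add one letter at a time, as the rules for
  \<open>D i (a j * x)\<close> require.\<close>

primrec left_span :: "('n \<Rightarrow> 'a) \<Rightarrow> 'a set \<Rightarrow> nat \<Rightarrow> 'a set" where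
  "left_span a U 0 = span U"
| "left_span a U (Suc k) = span {a i * x | i x. x \<in> left_span a U k}"

declare left_span.simps [simp del]

lemma left_span_base: "u \<in> U \<Longrightarrow> u \<in> left_span a U 0"
  by (simp add: left_span.simps span_base)

lemma left_span_mult: "x \<in> left_span a U k \<Longrightarrow> a i * x \<in> left_span a U (Suc k)"
  by (auto simp: left_span.simps intro!: span_base)

lemma subspace_left_span: "subspace (left_span a U k)"
  by (cases k) (auto simp: left_span.simps)

lemmas left_span_zero = subspace_0[OF subspace_left_span]
  and left_span_add = subspace_add[OF subspace_left_span]
  and left_span_scale = subspace_scale[OF subspace_left_span]
  and left_span_sum = subspace_sum[OF subspace_left_span]

lemmas left_span_intros =
  left_span_base left_span_mult left_span_zero left_span_add left_span_scale left_span_sum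

lemma left_span_induct [consumes 1, case_names base mult zero add scale]:
  assumes "x \<in> left_span a U k"
    and "\<And>u. u \<in> U \<Longrightarrow> P 0 u"
    and "\<And>k x i. x \<in> left_span a U k \<Longrightarrow> P k x \<Longrightarrow> P (Suc k) (a i * x)"
    and "\<And>k. P k 0"
    and "\<And>k x y. P k x \<Longrightarrow> P k y \<Longrightarrow> P k (x + y)"
    and "\<And>k c x. P k x \<Longrightarrow> P k (c *s x)"
  shows "P k x"
  using assms(1)
proof (induction k arbitrary: x)
  case 0
  then show ?case
    unfolding left_span.simps
    by (rule span_induct) (use assms in \<open>auto intro: subspaceI\<close>)
next
  case (Suc k)
  from Suc.prems show ?case
    unfolding left_span.simps
    by (rule span_induct) (use assms Suc.IH in \<open>auto intro: subspaceI\<close>)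
qed

end

section \<open>Ordered monomials in q-commuting elements\<close>

text \<open>Abstracts \<open>zmon\<close> and \<open>wmon\<close> from \<open>\<pi>\<close>, so that
  one theory serves both families of generators.\<close>

definition ordmon :: "('n::{finite,linorder} \<Rightarrow> 'a::ring_1) \<Rightarrow> ('n \<Rightarrow> nat) \<Rightarrow> 'a" where
  "ordmon a r = prod_list (map (\<lambda>i. a i ^ r i) (sorted_list_of_set UNIV))"

lemma ordmon_one: "ordmon (a :: 'a::{finite,linorder} \<Rightarrow> 'b::ring_1) (\<lambda>_. 0) = 1"
proof -
  have "prod_list (map (\<lambda>_. 1) xs) = (1 :: 'b)" for xs :: "'a list"
    by (induction xs) auto
  then show ?thesis
    by (simp add: ordmon_def)
qed

locale q_commuting = complex_algebra scale
  for scale :: "complex \<Rightarrow> 'a :: ring_1 \<Rightarrow> 'a" (infixr "*s" 75) +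
  fixes a :: "'n::{finite,linorder} \<Rightarrow> 'a" and p :: complex
  assumes p_nonzero [simp]: "p \<noteq> 0"
    and a_comm: "i < j \<Longrightarrow> a i * a j = p *s (a j * a i)"
begin

lemma a_power_comm: "i < j \<Longrightarrow> a i ^ k * a j = p ^ k *s (a j * a i ^ k)"
proof (induction k)
  case (Suc k)
  have "a i ^ Suc k * a j = a i * (a i ^ k * a j)"
    by (simp add: mult.assoc)
  also have "\<dots> = p ^ k *s ((a i * a j) * a i ^ k)"
    by (simp only: Suc mult_scale_right mult.assoc)
  also have "\<dots> = p ^ Suc k *s (a j * a i ^ Suc k)"
    by (simp add: a_comm[OF Suc.prems] scale_mult_left mult.assoc mult.commute)
  finally show ?case .
qed simp

text \<open>\<open>a i\<close> has to pass exactly the powers of the smaller \<open>a j\<close>, and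
  each letter passed costs a factor \<open>inverse p\<close>.\<close>

lemma mult_a_prod_list:
  assumes "sorted xs" "distinct xs" "i \<in> set xs"
  shows "a i * prod_list (map (\<lambda>k. a k ^ r k) xs) =
    inverse p ^ (\<Sum>j | j \<in> set xs \<and> j < i. r j) *s
      prod_list (map (\<lambda>k. a k ^ (r(i := Suc (r i))) k) xs)"
  using assms
proof (induction xs)
  case (Cons x xs)
  show ?case
  proof (cases "i = x")
    case True
    with Cons.prems have "{j. j \<in> set (x # xs) \<and> j < i} = {}"
      by auto
    then have "(\<Sum>j | j \<in> set (x # xs) \<and> j < i. r j) = 0"
      by (simp only: sum.empty)
    moreover have "map (\<lambda>k. a k ^ (r(i := Suc (r i))) k) xs = map (\<lambda>k. a k ^ r k) xs"
      using Cons.prems True by auto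
    ultimately show ?thesis
      using True by (simp only: list.map prod_list.Cons) (simp add: mult.assoc)
  next
    case False
    with Cons.prems have i: "i \<in> set xs" "x < i"
      by auto
    have *: "{j \<in> set (x # xs). j < i} = insert x {j \<in> set xs. j < i}"
      using i by auto
    have sum: "(\<Sum>j | j \<in> set (x # xs) \<and> j < i. r j) = r x + (\<Sum>j | j \<in> set xs \<and> j < i. r j)"
      unfolding * using Cons.prems by (subst sum.insert) auto
    let ?P = "prod_list (map (\<lambda>k. a k ^ r k) xs)"
    have "a i * a x ^ r x = inverse p ^ r x *s (a x ^ r x * a i)"
      using i by (simp add: a_power_comm power_inverse)
    then have "a i * prod_list (map (\<lambda>k. a k ^ r k) (x # xs)) =
        inverse p ^ r x *s (a x ^ r x * (a i * ?P))"
      by (simp add: mult.assoc[symmetric] scale_mult_left)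
    also have "a i * ?P = inverse p ^ (\<Sum>j | j \<in> set xs \<and> j < i. r j) *s
      prod_list (map (\<lambda>k. a k ^ (r(i := Suc (r i))) k) xs)"
      using Cons i by simp
    finally show ?thesis
      unfolding sum using False by (simp add: mult_scale_right power_add)
  qed
qed simp

lemma mult_a_ordmon:
  "a i * ordmon a r = inverse p ^ (\<Sum>j | j < i. r j) *s ordmon a (r(i := Suc (r i)))"
  using mult_a_prod_list[of "sorted_list_of_set UNIV" i r] by (simp add: ordmon_def)

text \<open>By \<open>mult_a_ordmon\<close>, a letter times an ordered monomial is a multiple of an
  ordered monomial of degree one higher, so reordering never leaves the span.\<close>

lemma left_span_subset_span_ordmon:
  "left_span a U k \<subseteq> span {ordmon a r * u | r u. (\<Sum>i\<in>UNIV. r i) = k \<and> u \<in> U}"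
    (is "_ \<subseteq> span (?M k)")
proof
  fix x assume "x \<in> left_span a U k"
  then show "x \<in> span (?M k)"
  proof (induction rule: left_span_induct)
    case (base u)
    then have "ordmon a (\<lambda>_. 0) * u \<in> ?M 0"
      by auto
    then show ?case
      by (simp add: ordmon_one span_base)
  next
    case (mult k x i)
    from mult.IH show ?case
    proof (induction rule: span_induct)
      case base
      show ?case
        by (auto intro!: subspaceI span_zero span_add span_scale simp: distrib_left mult_scale_right)
    next
      case (step x)
      then obtain r u where ru: "x = ordmon a r * u" "(\<Sum>i\<in>UNIV. r i) = k" "u \<in> U"
        by blast
      have "(\<Sum>j\<in>UNIV. (r(i := Suc (r i))) j) = Suc k"
        unfolding ru(2)[symmetric] by (simp add: sum.remove[of UNIV i])
      then have "ordmon a (r(i := Suc (r i))) * u \<in> ?M (Suc k)"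
        using ru by blast
      then show ?case
        by (simp add: ru mult.assoc[symmetric] mult_a_ordmon scale_mult_left span_base span_scale)
    qed
  qed (auto intro: span_zero span_add span_scale)
qed

end

section \<open>The calculus of q-derivations\<close>

text \<open>To be used with \<open>p = q\<close> and with \<open>p = inverse q\<close>.
  \<open>D_ordmon\<close> prescribes the values for all right factors \<open>u\<close> of degree
  \<open>l\<close> in the \<open>b j\<close>, so no order among the \<open>b j\<close>
  enters.\<close>

locale q_derivations = q_commuting scale a p
  for scale :: "complex \<Rightarrow> 'a :: ring_1 \<Rightarrow> 'a" (infixr "*s" 75)
    and a :: "'n::{finite,linorder} \<Rightarrow> 'a" and p :: complex +
  fixes b :: "'n \<Rightarrow> 'a" and D :: "'n \<Rightarrow> 'a \<Rightarrow> 'a"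
  assumes p_square: "p\<^sup>2 \<noteq> 1"
    and b_a: "i \<noteq> j \<Longrightarrow> b j * a i = p *s (a i * b j)"
    and b_a_same: "b k * a k = a k * b k + (1 - p\<^sup>2) *s (\<Sum>s | s < k. a s * b s)"
    and D_linear: "Vector_Spaces.linear scale scale (D i)"
    and D_ordmon: "u \<in> left_span b {1} l \<Longrightarrow> D i (ordmon a r * u) =
      (p ^ (\<Sum>j | i < j. r j) * qnum p (int (r i))) *s (ordmon a (r(i := r i - 1)) * u)"
begin

text \<open>The bidegree component, written with the \<open>a i\<close> on the left;
  \<open>b_bihom\<close> shows that it also absorbs a \<open>b j\<close> from the left.\<close>

abbreviation bihom :: "nat \<Rightarrow> nat \<Rightarrow> 'a set" where
  "bihom m k \<equiv> left_span a (left_span b {1} k) m"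

definition Q :: 'a where
  "Q = (\<Sum>j\<in>UNIV. a j * b j)"

lemma p_diff_nonzero: "p - inverse p \<noteq> 0"
  using p_square by (auto simp: power2_eq_square field_simps)

lemma D_add: "D i (x + y) = D i x + D i y"
  and D_scale: "D i (c *s x) = c *s D i x"
  using D_linear by (auto simp: Vector_Spaces.linear_iff)

lemma D_zero [simp]: "D i 0 = 0"
  using D_scale[of i 0 0] by simp

lemma D_sum: "D i (sum f I) = (\<Sum>j\<in>I. D i (f j))"
  by (induction I rule: infinite_finite_induct) (auto simp: D_add)

lemma D_base: "u \<in> left_span b {1} k \<Longrightarrow> D i u = 0"
  using D_ordmon[of u k i "\<lambda>_. 0"]
  by (simp add: ordmon_one)

text \<open>Reduces claims that are linear in \<open>x\<close> to ordered monomials, where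
  \<open>D i\<close> is explicit.\<close>

lemma bihom_monomial_induct [consumes 1, case_names ordmon zero add scale]:
  assumes "x \<in> bihom m k"
    and "\<And>r u. (\<Sum>i\<in>UNIV. r i) = m \<Longrightarrow> u \<in> left_span b {1} k \<Longrightarrow> P (ordmon a r * u)"
    and "P 0" "\<And>x y. P x \<Longrightarrow> P y \<Longrightarrow> P (x + y)" "\<And>c x. P x \<Longrightarrow> P (c *s x)"
  shows "P x"
proof -
  have "x \<in> span {ordmon a r * u | r u. (\<Sum>i\<in>UNIV. r i) = m \<and> u \<in> left_span b {1} k}"
    using assms(1) left_span_subset_span_ordmon by blast
  then show ?thesis
    by (rule span_induct) (use assms in \<open>auto intro: subspaceI\<close>)
qed

text \<open>If \<open>i < j\<close>, inserting \<open>a j\<close> before applying \<open>D i\<close>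
  gains a factor \<open>p\<close> from the larger exponent at \<open>j\<close> and a factor
  \<open>inverse p\<close> from passing one more \<open>a i\<close>; they cancel. If
  \<open>j < i\<close>, neither exponent changes.\<close>

lemma D_a_mult_neq:
  assumes "x \<in> bihom m k" "i \<noteq> j"
  shows "D i (a j * x) = a j * D i x"
  using assms(1)
proof (induction rule: bihom_monomial_induct)
  case (ordmon r u)
  show ?case
  proof (cases "r i")
    case 0
    with \<open>i \<noteq> j\<close> show ?thesis
      by (simp add: D_ordmon[OF ordmon(2)] D_scale mult.assoc[symmetric] mult_a_ordmon
          scale_mult_left)
  next
    case (Suc l)
    let ?r' = "r(i := l)"
    have gt: "(\<Sum>k | i < k. (r(j := Suc (r j))) k) = (\<Sum>k | i < k. r k) + (if i < j then 1 else 0)"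
    proof (cases "i < j")
      case True
      then show ?thesis
        by (simp add: sum.remove[of "{k. i < k}" j])
    next
      case False
      then show ?thesis
        by (auto intro!: sum.cong)
    qed
    have lt: "(\<Sum>k | k < j. r k) = (\<Sum>k | k < j. ?r' k) + (if i < j then 1 else 0)"
    proof (cases "i < j")
      case True
      then show ?thesis
        by (simp add: Suc sum.remove[of "{k. k < j}" i])
    next
      case False
      then show ?thesis
        by (auto intro!: sum.cong)
    qed
    have upd: "(r(j := Suc (r j)))(i := l) = ?r'(j := Suc (?r' j))"
      using \<open>i \<noteq> j\<close> by (simp add: fun_upd_twist)
    have "D i (a j * (ordmon a r * u)) =
        (inverse p ^ (\<Sum>k | k < j. r k) *
          (p ^ (\<Sum>k | i < k. (r(j := Suc (r j))) k) * qnum p (int (r i)))) *s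
          (ordmon a ((r(j := Suc (r j)))(i := l)) * u)"
      using \<open>i \<noteq> j\<close> Suc
      by (simp add: mult.assoc[symmetric] mult_a_ordmon scale_mult_left D_scale
          D_ordmon[OF ordmon(2)] del: fun_upd_apply) simp
    also have "\<dots> = (p ^ (\<Sum>k | i < k. r k) * qnum p (int (r i)) *
        inverse p ^ (\<Sum>k | k < j. ?r' k)) *s (ordmon a (?r'(j := Suc (?r' j))) * u)"
      unfolding gt lt upd by (simp add: mult_ac del: fun_upd_apply)
    also have "\<dots> = a j * D i (ordmon a r * u)"
      using Suc
      by (simp add: D_ordmon[OF ordmon(2)] mult_scale_right mult.assoc[symmetric] mult_a_ordmon
          scale_mult_left del: fun_upd_apply)
    finally show ?thesis .
  qed
qed (simp_all add: D_add D_scale distrib_left scale_right_distrib mult_scale_right)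

text \<open>\<open>D j\<close> removes a letter and \<open>mult_a_ordmon\<close> puts it back, so
  ordered monomials are eigenvectors of the operators \<open>a j * D j\<close>.\<close>

lemma a_D_ordmon:
  assumes "u \<in> left_span b {1} k"
  shows "a j * D j (ordmon a r * u) =
    (p ^ (\<Sum>k | j < k. r k) * inverse p ^ (\<Sum>k | k < j. r k) * qnum p (int (r j))) *s
      (ordmon a r * u)"
proof (cases "r j")
  case 0
  then show ?thesis
    by (simp add: D_ordmon[OF assms])
next
  case (Suc l)
  have "(\<Sum>k | k < j. (r(j := l)) k) = (\<Sum>k | k < j. r k)"
    by (rule sum.cong) auto
  moreover have "r(j := Suc l) = r"
    using Suc by auto
  ultimately show ?thesis
    using mult_a_ordmon[of j "r(j := l)"] Suc
    by (simp add: D_ordmon[OF assms] mult_scale_right mult.assoc[symmetric] scale_mult_left)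
qed

text \<open>Splitting \<open>m\<close> into the exponents below, at and above \<open>j\<close> turns
  the eigenvalues of \<open>a_D_ordmon\<close> into differences of a function of initial segments,
  which can telescope.\<close>

lemma power_split:
  fixes r :: "'n \<Rightarrow> nat"
  assumes "(\<Sum>i\<in>UNIV. r i) = m"
  shows "p ^ m * inverse p ^ (2 * (\<Sum>k | k < j. r k)) =
      p ^ (\<Sum>k | j < k. r k) * inverse p ^ (\<Sum>k | k < j. r k) * p ^ r j" (is ?lt)
    and "p ^ m * inverse p ^ (2 * (\<Sum>k | k \<le> j. r k)) =
      p ^ (\<Sum>k | j < k. r k) * inverse p ^ (\<Sum>k | k < j. r k) * inverse p ^ r j" (is ?le)
proof -
  have "UNIV = insert j ({k. k < j} \<union> {k. j < k})"
    using less_linear[of _ j] by blast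
  then have "(\<Sum>i\<in>UNIV. r i) = r j + (sum r {k. k < j} + sum r {k. j < k})"
    by (subst sum.union_disjoint[symmetric]) (auto simp: sum.insert[symmetric])
  then have m: "m = (\<Sum>k | k < j. r k) + (\<Sum>k | j < k. r k) + r j"
    using assms by simp
  have "{k. k \<le> j} = insert j {k. k < j}"
    by auto
  then have le: "(\<Sum>k | k \<le> j. r k) = (\<Sum>k | k < j. r k) + r j"
    by simp
  have cancel: "p ^ l * (inverse p ^ l * c) = c" for l c
    by (simp add: mult.assoc[symmetric] power_mult_distrib[symmetric])
  show ?lt ?le
    unfolding m le by (simp_all only: power_add mult_2 distrib_left mult.assoc)
      (simp_all only: cancel mult_ac)
qed

text \<open>On an ordered monomial \<open>D i (a i * x)\<close> is a multiple of \<open>x\<close> that depends on the single exponents;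
  the sum over \<open>j < i\<close> telescopes and leaves only the total degree \<open>m\<close>.\<close>

lemma D_a_mult_same:
  assumes "x \<in> bihom m k"
  shows "D i (a i * x) = p ^ m *s x + inverse p *s (a i * D i x)
    - (p - inverse p) *s (\<Sum>j | j < i. a j * D j x)"
  using assms
proof (induction rule: bihom_monomial_induct)
  case (ordmon r u)
  let ?x = "ordmon a r * u"
  let ?A = "\<lambda>j. p ^ (\<Sum>k | j < k. r k) * inverse p ^ (\<Sum>k | k < j. r k)"
  \<comment> \<open>\<open>p - inverse p\<close> times the eigenvalue of \<open>a j * D j\<close> is
    the drop of \<open>G\<close> when \<open>j\<close> joins the initial segment below it.\<close>
  define G where "G S = p ^ m * inverse p ^ (2 * sum r S)" for S
  have G_diff: "(p - inverse p) * (?A j * qnum p (int (r j))) = G {k. k < j} - G {k. k \<le> j}" for j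
  proof -
    have "(p - inverse p) * qnum p (int (r j)) = p ^ r j - inverse p ^ r j"
      using p_diff_nonzero by (simp add: qnum_of_nat)
    then show ?thesis
      unfolding G_def power_split[OF ordmon(1)]
      by (simp add: mult.left_commute[of "p - inverse p"] right_diff_distrib)
  qed
  have "(p - inverse p) *s (\<Sum>j | j < i. a j * D j ?x) =
      (\<Sum>j | j < i. (p - inverse p) * (?A j * qnum p (int (r j)))) *s ?x"
    by (simp only: a_D_ordmon[OF ordmon(2)] scale_sum_right scale_sum_left scale_scale)
  \<comment> \<open>The initial segments are rewritten relative to \<open>{j. j < i}\<close>, the
    form that \<open>sum_telescope_linorder\<close> expects.\<close>
  also have "(\<Sum>j | j < i. (p - inverse p) * (?A j * qnum p (int (r j)))) =
      (\<Sum>j\<in>{j. j < i}. G {k \<in> {j. j < i}. k < j} - G {k \<in> {j. j < i}. k \<le> j})"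
    unfolding G_diff
    by (intro sum.cong refl arg_cong2[of _ _ _ _ minus] arg_cong[of _ _ G]) auto
  also have "\<dots> = G {} - G {j. j < i}"
    by (rule sum_telescope_linorder) simp
  also have "\<dots> = p ^ m - ?A i * p ^ r i"
    using power_split(1)[OF ordmon(1), of i] by (simp add: G_def)
  finally have sum: "(p - inverse p) *s (\<Sum>j | j < i. a j * D j ?x) =
    (p ^ m - ?A i * p ^ r i) *s ?x" .
  have "(\<Sum>j | i < j. (r(i := Suc (r i))) j) = (\<Sum>j | i < j. r j)"
    by (rule sum.cong) auto
  then have "D i (a i * ?x) = (?A i * qnum p (int (Suc (r i)))) *s ?x"
    by (simp add: mult.assoc[symmetric] mult_a_ordmon scale_mult_left D_scale
        D_ordmon[OF ordmon(2)] del: of_nat_Suc)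
  also have "\<dots> = (p ^ m + inverse p * (?A i * qnum p (int (r i))) - (p ^ m - ?A i * p ^ r i)) *s ?x"
    using qnum_Suc[OF p_nonzero p_square, of "r i"] by (simp add: algebra_simps)
  also have "\<dots> = p ^ m *s ?x + inverse p *s (a i * D i ?x)
      - (p - inverse p) *s (\<Sum>j | j < i. a j * D j ?x)"
    unfolding sum a_D_ordmon[OF ordmon(2), where j = i]
    by (simp add: scale_left_diff_distrib scale_left_distrib)
  finally show ?case .
next
  case (add x y)
  then show ?case
    by (simp add: D_add distrib_left scale_right_distrib sum.distrib)
next
  case (scale c x)
  then show ?case
    by (simp add: D_scale mult_scale_right scale_sum_right[symmetric] scale_right_distrib
        scale_right_diff_distrib mult.commute)
qed simp

lemma left_span_b_subspace: "span (left_span b {1} k) = left_span b {1} k"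
  using subspace_left_span by (rule span_eq_iff[THEN iffD2])

lemma D_bihom_0: "x \<in> bihom 0 k \<Longrightarrow> D i x = 0"
  using D_base by (simp add: left_span.simps left_span_b_subspace)

lemma sum_if_less: "(\<Sum>j\<in>UNIV. if j < k then f j else 0) = (\<Sum>j | j < k. f j)"
  for f :: "'n \<Rightarrow> 'a"
  by (simp add: sum.If_cases)

text \<open>In passing \<open>a k\<close>, the terms with \<open>j < k\<close> pick up
  \<open>p\<^sup>2\<close> and those with \<open>k < j\<close> nothing. The surplus
  \<open>p\<^sup>2 - 1\<close> is cancelled by the correction that \<open>b_a_same\<close> produces
  at \<open>j = k\<close>.\<close>

lemma Q_a_comm: "Q * a k = a k * Q"
proof -
  have "a j * b j * a k = a k * (a j * b j)
      + (if j < k then (p\<^sup>2 - 1) *s (a k * (a j * b j)) else 0)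
      + (if j = k then (1 - p\<^sup>2) *s (a k * (\<Sum>s | s < k. a s * b s)) else 0)" for j
  proof -
    consider "j < k" | "j = k" | "k < j"
      by (rule linorder_cases)
    then show ?thesis
    proof cases
      case 1
      then have "a j * b j * a k = p *s ((a j * a k) * b j)"
        by (simp add: mult.assoc b_a mult_scale_right)
      also have "\<dots> = p\<^sup>2 *s (a k * (a j * b j))"
        using 1 by (simp add: a_comm scale_mult_left mult.assoc power2_eq_square)
      finally show ?thesis
        using 1 by (simp add: mult.assoc scale_left_diff_distrib less_imp_neq)
    next
      case 2
      then show ?thesis
        by (simp add: mult.assoc b_a_same distrib_left mult_scale_right)
    next
      case 3
      then have "a j * b j * a k = (p *s (a j * a k)) * b j"
        by (simp add: mult.assoc b_a mult_scale_right scale_mult_left)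
      also have "p *s (a j * a k) = a k * a j"
        using a_comm[OF 3] by simp
      finally show ?thesis
        using less_not_sym[OF 3] less_imp_neq[OF 3] by (simp add: mult.assoc)
    qed
  qed
  then have "Q * a k = a k * Q + (p\<^sup>2 - 1) *s (a k * (\<Sum>s | s < k. a s * b s))
      + (1 - p\<^sup>2) *s (a k * (\<Sum>s | s < k. a s * b s))"
    by (simp add: Q_def sum_distrib_right sum.distrib sum_if_less sum_distrib_left scale_sum_right)
  then show ?thesis
    by (simp add: scale_left_diff_distrib)
qed

lemma b_bihom: "x \<in> bihom m k \<Longrightarrow> b j * x \<in> bihom m (Suc k)"
proof (induction arbitrary: j rule: left_span_induct)
  case (mult m x i)
  show ?case
  proof (cases "i = j")
    case True
    have "b j * (a j * x) = a j * (b j * x) + (1 - p\<^sup>2) *s (\<Sum>s | s < j. a s * (b s * x))"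
      by (simp add: mult.assoc[symmetric] b_a_same distrib_right scale_mult_left sum_distrib_right)
    then show ?thesis
      using True mult.IH by (auto intro!: left_span_intros)
  next
    case False
    then have "b j * (a i * x) = p *s (a i * (b j * x))"
      by (simp add: mult.assoc[symmetric] b_a scale_mult_left)
    then show ?thesis
      using mult.IH by (auto intro!: left_span_intros)
  qed
qed (auto simp: distrib_left mult_scale_right intro!: left_span_intros)

lemma Q_bihom: "x \<in> bihom m k \<Longrightarrow> Q * x \<in> bihom (Suc m) (Suc k)"
  unfolding Q_def sum_distrib_right mult.assoc
  by (intro left_span_sum left_span_mult b_bihom)

text \<open>The case distinction keeps the truncated \<open>m - 1\<close> from naming degree
  \<open>0\<close> when \<open>m = 0\<close>.\<close>

lemma D_lower: "x \<in> bihom m k \<Longrightarrow> D i x \<in> (if m = 0 then {0} else bihom (m - 1) k)"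
proof (induction arbitrary: i rule: left_span_induct)
  case (base u)
  then show ?case
    by (simp add: D_base)
next
  case (mult m x j)
  have *: "a j' * D i x \<in> bihom m k" for i j'
    using mult.IH[of i] left_span_mult[of "D i x" a _ "m - 1" j']
    by (cases m) (auto intro: left_span_zero)
  show ?case
  proof (cases "i = j")
    case True
    then show ?thesis
      using mult.hyps * by (simp add: D_a_mult_same subspace_diff[OF subspace_left_span] left_span_intros)
  next
    case False
    then show ?thesis
      using D_a_mult_neq[OF mult.hyps] * by simp
  qed
qed (auto simp: D_add D_scale intro: left_span_intros)

text \<open>When a letter \<open>a k\<close> is added, the surplus \<open>p - inverse p\<close> of
  the terms with \<open>i < k\<close> cancels the tail of \<open>D_a_mult_same\<close> at
  \<open>i = k\<close>. What remains is the recursion \<open>qnum_Suc\<close> for the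
  eigenvalue.\<close>

lemma euler:
  "x \<in> bihom m k \<Longrightarrow> (\<Sum>i\<in>UNIV. a i * D i x) = qnum p (int m) *s x"
proof (induction rule: left_span_induct)
  case (base u)
  then show ?case
    by (simp add: D_base)
next
  case (mult m x k)
  have "a i * D i (a k * x) = inverse p *s (a k * (a i * D i x))
      + (if i < k then (p - inverse p) *s (a k * (a i * D i x)) else 0)
      + (if i = k then p ^ m *s (a k * x)
          - (p - inverse p) *s (a k * (\<Sum>j | j < k. a j * D j x)) else 0)" for i
  proof -
    consider "i < k" | "i = k" | "k < i"
      by (rule linorder_cases)
    then show ?thesis
    proof cases
      case 1
      then have "a i * D i (a k * x) = p *s (a k * (a i * D i x))"
        by (simp add: D_a_mult_neq[OF mult.hyps] mult.assoc[symmetric] a_comm scale_mult_left)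
      then show ?thesis
        using 1 by (simp add: scale_left_diff_distrib less_imp_neq)
    next
      case 2
      then show ?thesis
        by (simp add: D_a_mult_same[OF mult.hyps] distrib_left right_diff_distrib mult_scale_right)
    next
      case 3
      then have "a i * D i (a k * x) = inverse p *s ((p *s (a i * a k)) * D i x)"
        by (simp add: D_a_mult_neq[OF mult.hyps] mult.assoc scale_mult_left)
      also have "p *s (a i * a k) = a k * a i"
        using a_comm[OF 3] by simp
      finally show ?thesis
        using less_not_sym[OF 3] less_imp_neq[OF 3] by (simp add: mult.assoc)
    qed
  qed
  then have "(\<Sum>i\<in>UNIV. a i * D i (a k * x)) =
      inverse p *s (a k * (\<Sum>i\<in>UNIV. a i * D i x)) + p ^ m *s (a k * x)"
    by (simp add: sum.distrib sum_if_less sum_distrib_left scale_sum_right)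
  also have "\<dots> = qnum p (int (Suc m)) *s (a k * x)"
    unfolding qnum_Suc[OF p_nonzero p_square]
    by (simp add: mult.IH mult_scale_right scale_left_distrib)
  finally show ?case .
qed (simp_all add: D_add D_scale distrib_left sum.distrib scale_right_distrib mult_scale_right
    scale_sum_right[symmetric] mult.commute)

text \<open>Since \<open>Q\<close> commutes with \<open>a j\<close>, the rules for
  \<open>D i\<close> past \<open>a j\<close> apply to \<open>Q * x\<close>. Each letter contributes
  one factor \<open>inverse p\<close>, from \<open>b_a\<close> if \<open>i \<noteq> j\<close> and
  from \<open>D_a_mult_same\<close> if \<open>i = j\<close>.\<close>

lemma D_Q_mult:
  "x \<in> bihom m k \<Longrightarrow>
    D i (Q * x) = p *s (Q * D i x) + inverse p ^ m *s (b i * x)"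
proof (induction arbitrary: i rule: left_span_induct)
  case (base u)
  have "b j * u \<in> bihom 0 (Suc k)" for j
    by (intro left_span_base left_span_mult base)
  note bu = this D_bihom_0[OF this]
  \<comment> \<open>\<open>b j * u\<close> has degree \<open>0\<close> in the \<open>a i\<close>, so
    every \<open>D i\<close> kills it and only the term \<open>p ^ 0 *s (b i * u)\<close>
    survives.\<close>
  have "D i (a j * (b j * u)) = (if i = j then b i * u else 0)" for j
    using D_a_mult_neq[OF bu(1)] D_a_mult_same[OF bu(1)] bu(2) by simp
  then have "D i (Q * u) = b i * u"
    by (simp add: Q_def sum_distrib_right mult.assoc D_sum)
  then show ?case
    using base by (simp add: D_base)
next
  case (mult m x j)
  have Qx: "Q * x \<in> bihom (Suc m) (Suc k)"
    using mult.hyps by (rule Q_bihom)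
  have Qa: "Q * (a j * y) = a j * (Q * y)" for y j
    by (simp add: mult.assoc[symmetric] Q_a_comm)
  show ?case
  proof (cases "i = j")
    case False
    then have "b i * (a j * x) = p *s (a j * (b i * x))"
      by (simp add: mult.assoc[symmetric] b_a scale_mult_left)
    moreover have "D i (Q * (a j * x)) = a j * (p *s (Q * D i x) + inverse p ^ m *s (b i * x))"
      by (simp add: Qa D_a_mult_neq[OF Qx False] mult.IH)
    ultimately show ?thesis
      using False by (simp add: D_a_mult_neq[OF mult.hyps] distrib_left mult_scale_right Qa)
  next
    case True
    define S1 where "S1 = (\<Sum>s | s < i. a s * D s x)"
    define S2 where "S2 = (\<Sum>s | s < i. a s * (b s * x))"
    have sum: "(\<Sum>s | s < i. a s * D s (Q * x)) = p *s (Q * S1) + inverse p ^ m *s S2"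
      by (simp add: mult.IH S1_def S2_def distrib_left mult_scale_right sum.distrib scale_sum_right
          sum_distrib_left Qa)
    have bax: "b i * (a i * x) = a i * (b i * x) + (1 - p\<^sup>2) *s S2"
      by (simp add: S2_def mult.assoc[symmetric] b_a_same distrib_right scale_mult_left
          sum_distrib_right)
    have "D i (Q * (a i * x)) = p ^ Suc m *s (Q * x)
        + inverse p *s (a i * (p *s (Q * D i x) + inverse p ^ m *s (b i * x)))
        - (p - inverse p) *s (p *s (Q * S1) + inverse p ^ m *s S2)"
      unfolding Qa D_a_mult_same[OF Qx] sum mult.IH[of i] by simp
    also have "\<dots> = p *s (Q * D i (a i * x)) + inverse p ^ Suc m *s (b i * (a i * x))"
    proof -
      \<comment> \<open>This matches the correction in \<open>b_a_same\<close> with the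
        \<open>S2\<close> part of the tail of \<open>D_a_mult_same\<close>.\<close>
      have "inverse p ^ Suc m * (1 - p\<^sup>2) = - ((p - inverse p) * inverse p ^ m)"
        by (simp add: power2_eq_square algebra_simps)
      then have "inverse p ^ Suc m *s (b i * (a i * x)) =
          inverse p ^ Suc m *s (a i * (b i * x)) - ((p - inverse p) * inverse p ^ m) *s S2"
        unfolding bax by (simp only: scale_right_distrib scale_scale scale_minus_left) simp
      moreover have "p *s (Q * D i (a i * x)) = p ^ Suc m *s (Q * x) + a i * (Q * D i x)
          - ((p - inverse p) * p) *s (Q * S1)"
        unfolding D_a_mult_same[OF mult.hyps] S1_def[symmetric]
        by (simp add: distrib_left right_diff_distrib mult_scale_right scale_right_distrib
            scale_right_diff_distrib Qa mult.commute)
      ultimately show ?thesis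
        by (simp add: distrib_left mult_scale_right scale_right_distrib scale_right_diff_distrib)
    qed
    finally show ?thesis
      using True by simp
  qed
qed (simp_all add: D_add D_scale distrib_left scale_right_distrib mult_scale_right mult.commute)

text \<open>The weights are chosen so that, once the double sum over \<open>j < i\<close> is
  exchanged, every \<open>a j * D j x\<close> has the same coefficient and \<open>euler\<close>
  applies.\<close>

lemma sum_D_a_mult:
  assumes "x \<in> bihom m k"
  shows "(\<Sum>i\<in>UNIV. (p\<^sup>2) ^ card {k. i < k} *s D i (a i * x)) =
    (p ^ (CARD('n) - 1) * qnum p (int (m + CARD('n)))) *s x"
proof -
  define g where "g i = (p\<^sup>2) ^ card {k. i < k}" for i :: 'n
  have g_above: "(p - inverse p) * (\<Sum>i | j < i. g i) = inverse p * (g j - 1)" for j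
  proof -
    have "(p\<^sup>2 - 1) * (\<Sum>i\<in>{i. j < i}. (p\<^sup>2) ^ card {k \<in> {i. j < i}. i < k}) = g j - 1"
      unfolding g_def by (rule geometric_sum_linorder) simp
    moreover have "{k \<in> {i. j < i}. i < k} = {k. i < k}" if "j < i" for i
      using that by auto
    ultimately have "(p\<^sup>2 - 1) * (\<Sum>i | j < i. g i) = g j - 1"
      by (simp add: g_def)
    moreover have "p - inverse p = inverse p * (p\<^sup>2 - 1)"
      by (simp add: power2_eq_square right_diff_distrib)
    ultimately show ?thesis
      by (simp add: mult.assoc)
  qed
  have "(\<Sum>i\<in>UNIV. g i *s (\<Sum>j | j < i. a j * D j x)) =
      (\<Sum>j\<in>UNIV. (\<Sum>i | j < i. g i) *s (a j * D j x))"
    unfolding scale_sum_right scale_sum_left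
    by (rule sum.swap_restrict[of UNIV UNIV "\<lambda>i j. g i *s (a j * D j x)" "\<lambda>i j. j < i", simplified])
  then have swap: "(p - inverse p) *s (\<Sum>i\<in>UNIV. g i *s (\<Sum>j | j < i. a j * D j x)) =
      (\<Sum>j\<in>UNIV. (inverse p * (g j - 1)) *s (a j * D j x))"
    by (simp only: scale_sum_right scale_scale g_above)
  have "(\<Sum>i\<in>UNIV. g i *s D i (a i * x)) = ((\<Sum>i\<in>UNIV. g i) * p ^ m) *s x
      + (\<Sum>i\<in>UNIV. (inverse p * g i) *s (a i * D i x))
      - (p - inverse p) *s (\<Sum>i\<in>UNIV. g i *s (\<Sum>j | j < i. a j * D j x))"
    unfolding D_a_mult_same[OF assms]
    by (simp add: scale_right_distrib scale_right_diff_distrib sum.distrib sum_subtractf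
        scale_sum_left sum_distrib_right scale_sum_right mult.commute)
  \<comment> \<open>\<open>inverse p * g j\<close> minus the exchanged tail
    \<open>inverse p * (g j - 1)\<close> leaves \<open>inverse p\<close> for every
    \<open>j\<close>.\<close>
  also have "\<dots> = ((\<Sum>i\<in>UNIV. g i) * p ^ m) *s x
      + inverse p *s (\<Sum>i\<in>UNIV. a i * D i x)"
    unfolding swap
    by (simp add: scale_sum_right sum_subtractf[symmetric] scale_left_diff_distrib[symmetric]
        right_diff_distrib)
  also have "\<dots> = ((\<Sum>i\<in>UNIV. g i) * p ^ m + inverse p * qnum p (int m)) *s x"
    by (simp add: euler[OF assms] scale_left_distrib)
  also have "(\<Sum>i\<in>UNIV. g i) * p ^ m + inverse p * qnum p (int m) =
      p ^ (CARD('n) - 1) * qnum p (int (m + CARD('n)))"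
  proof -
    obtain n where n: "CARD('n) = Suc n"
      using zero_less_card_finite[where 'a = 'n] by (metis gr0_conv_Suc)
    have "(p\<^sup>2 - 1) * (\<Sum>i\<in>UNIV. g i) = (p\<^sup>2) ^ Suc n - 1"
      using geometric_sum_linorder[of "UNIV :: 'n set" "p\<^sup>2"] by (simp add: g_def n)
    moreover have "p\<^sup>2 - 1 \<noteq> 0" "p - inverse p = inverse p * (p\<^sup>2 - 1)"
      using p_square by (simp_all add: power2_eq_square right_diff_distrib)
    ultimately have "(\<Sum>i\<in>UNIV. g i) = ((p\<^sup>2) ^ Suc n - 1) / (p\<^sup>2 - 1)"
      by (simp add: nonzero_eq_divide_eq mult.commute)
    then show ?thesis
      unfolding n by (simp only: qnum_add_geometric[OF p_nonzero p_square])
  qed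
  finally show ?thesis
    unfolding g_def .
qed

end

section \<open>Projecting along a lowering and a raising operator\<close>

context complex_algebra
begin

text \<open>In the next two lemmas the truncated exponent \<open>k - 1\<close> is harmless at \<open>k = 0\<close>, where its
  coefficient is an empty sum.\<close>

lemma lap_Q_power:
  fixes X :: "nat \<Rightarrow> 'a set"
  assumes Q_X: "\<And>j x. x \<in> X (Suc j) \<Longrightarrow> Qe * x \<in> X j"
    and comm: "\<And>j x. x \<in> X (Suc j) \<Longrightarrow> L (Qe * x) = Qe * L x + c (Suc j) *s x"
    and x: "x \<in> X (j + k)"
  shows "Qe ^ k * x \<in> X j \<and> L (Qe ^ k * x) =
    Qe ^ k * L x + (\<Sum>i<k. c (Suc (j + i))) *s (Qe ^ (k - 1) * x)"
  using x
proof (induction k arbitrary: j)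
  case (Suc k)
  then have "x \<in> X (Suc j + k)"
    by simp
  note IH = Suc.IH[OF this]
  have "L (Qe ^ Suc k * x) = L (Qe * (Qe ^ k * x))"
    by (simp add: mult.assoc)
  also have "\<dots> = Qe * L (Qe ^ k * x) + c (Suc j) *s (Qe ^ k * x)"
    using IH by (intro comm) simp
  also have "\<dots> = Qe ^ Suc k * L x
      + (\<Sum>i<k. c (Suc (Suc j + i))) *s (Qe * Qe ^ (k - 1) * x) + c (Suc j) *s (Qe ^ k * x)"
    using IH by (simp add: distrib_left mult_scale_right mult.assoc)
  also have "(\<Sum>i<k. c (Suc (Suc j + i))) *s (Qe * Qe ^ (k - 1) * x) =
      (\<Sum>i<k. c (Suc (Suc j + i))) *s (Qe ^ k * x)"
    by (cases k) simp_all
  also have "Qe ^ Suc k * L x + \<dots> + c (Suc j) *s (Qe ^ k * x) =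
      Qe ^ Suc k * L x + (\<Sum>i<Suc k. c (Suc (j + i))) *s (Qe ^ (Suc k - 1) * x)"
    by (simp add: sum.lessThan_Suc_shift scale_left_distrib del: sum.lessThan_Suc)
  finally show ?case
    using IH Q_X[of "Qe ^ k * x" j] by (simp add: mult.assoc)
qed simp

lemma lap_power_Q:
  fixes X :: "nat \<Rightarrow> 'a set"
  assumes L_X: "\<And>j x. x \<in> X j \<Longrightarrow> L x \<in> X (Suc j)"
    and L_add: "\<And>x y. L (x + y) = L x + L y"
    and L_scale: "\<And>c x. L (c *s x) = c *s L x"
    and comm: "\<And>j x. x \<in> X (Suc j) \<Longrightarrow> L (Qe * x) = Qe * L x + c (Suc j) *s x"
    and x: "x \<in> X 1"
  shows "(L ^^ k) x \<in> X (Suc k) \<and> (L ^^ k) (Qe * x) =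
    Qe * (L ^^ k) x + (\<Sum>i<k. c (Suc i)) *s (L ^^ (k - 1)) x"
proof (induction k)
  case 0
  then show ?case
    using x by simp
next
  case (Suc k)
  then have "(L ^^ Suc k) (Qe * x) = Qe * L ((L ^^ k) x) + c (Suc k) *s (L ^^ k) x
      + (\<Sum>i<k. c (Suc i)) *s L ((L ^^ (k - 1)) x)"
    by (simp add: L_add L_scale comm)
  also have "(\<Sum>i<k. c (Suc i)) *s L ((L ^^ (k - 1)) x) = (\<Sum>i<k. c (Suc i)) *s (L ^^ k) x"
    by (cases k) simp_all
  finally show ?case
    using Suc L_X by (simp add: scale_left_distrib add_ac)
qed

text \<open>\<open>X j\<close> is the component reached after \<open>j\<close> applications of
  \<open>L\<close>. On \<open>X 0\<close> the candidate \<open>P\<close> has values in the kernel of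
  \<open>L\<close>, kills \<open>V\<close> and fixes that kernel; this gives the decomposition and
  identifies the projector. \<open>\<alpha>_Suc\<close> is the recursion that makes the sums
  telescope.\<close>

lemma fischer_projector:
  fixes X :: "nat \<Rightarrow> 'a set" and M :: nat
  assumes X: "\<And>j. subspace (X j)" "X (Suc M) = {0}"
    and Q_X: "\<And>j x. x \<in> X (Suc j) \<Longrightarrow> Qe * x \<in> X j"
    and L_X: "\<And>j x. x \<in> X j \<Longrightarrow> L x \<in> X (Suc j)"
    and L_add: "\<And>x y. L (x + y) = L x + L y"
    and L_scale: "\<And>c x. L (c *s x) = c *s L x"
    and comm: "\<And>j x. x \<in> X (Suc j) \<Longrightarrow> L (Qe * x) = Qe * L x + c (Suc j) *s x"
    and \<alpha>_0: "\<alpha> 0 = 1"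
    and \<alpha>_Suc: "\<And>k. k < M \<Longrightarrow> \<alpha> (Suc k) * (\<Sum>i<Suc k. c (Suc i)) = - \<alpha> k"
  defines "H \<equiv> X 0 \<inter> {p. L p = 0}" and "V \<equiv> {Qe * x | x. x \<in> X 1}"
  shows "direct_sum (X 0) H V" and
    "p \<in> X 0 \<Longrightarrow> projector H V p = (\<Sum>k=0..M. \<alpha> k *s (Qe ^ k * (L ^^ k) p))"
proof -
  define P where "P p = (\<Sum>k=0..M. \<alpha> k *s (Qe ^ k * (L ^^ k) p))" for p
  have L_zero: "L 0 = 0"
    using L_scale[of 0 0] by simp
  have L_sum: "L (sum f I) = (\<Sum>k\<in>I. L (f k))" for f and I :: "nat set"
    by (induction I rule: infinite_finite_induct) (simp_all add: L_add L_zero)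
  have pow_add: "(L ^^ k) (x + y) = (L ^^ k) x + (L ^^ k) y" for k x y
    by (induction k) (simp_all add: L_add)
  have P_add: "P (x + y) = P x + P y" for x y
    by (simp add: P_def pow_add distrib_left scale_right_distrib sum.distrib)
  have pow_X: "(L ^^ k) x \<in> X (j + k)" if "x \<in> X j" for j k x
    using that by (induction k) (auto intro: L_X)
  note Q_pow = lap_Q_power[where X = X and Qe = Qe and L = L and c = c, OF Q_X comm]
  have P_harm: "L (P p) = 0" if p: "p \<in> X 0" for p
  proof -
    \<comment> \<open>By \<open>\<alpha>_Suc\<close>, the part of the \<open>k\<close>-th summand
      that carries the constants \<open>c\<close> is \<open>- t (k - 1)\<close>.\<close>
    define t where "t k = \<alpha> k *s (Qe ^ k * (L ^^ Suc k) p)" for k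
    have "L (\<alpha> k *s (Qe ^ k * (L ^^ k) p)) = t k - (if k = 0 then 0 else t (k - 1))"
      if "k \<le> M" for k
    proof -
      have "L (Qe ^ k * (L ^^ k) p) = Qe ^ k * (L ^^ Suc k) p
          + (\<Sum>i<k. c (Suc i)) *s (Qe ^ (k - 1) * (L ^^ k) p)"
        using Q_pow[of "(L ^^ k) p" 0 k] pow_X[OF p, of k] by simp
      then show ?thesis
        using that \<alpha>_Suc[of "k - 1"] L_scale
        by (cases k) (simp_all add: t_def scale_right_distrib del: sum.lessThan_Suc)
    qed
    then have "L (P p) = (\<Sum>k=0..M. t k - (if k = 0 then 0 else t (k - 1)))"
      by (simp add: P_def L_sum)
    also have "\<dots> = t M"
      by (induction M) simp_all
    \<comment> \<open>\<open>t M\<close> contains \<open>(L ^^ Suc M) p\<close>, which lies in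
      \<open>X (Suc M) = {0}\<close>.\<close>
    also have "\<dots> = 0"
      using pow_X[OF p, of "Suc M"] X(2) by (simp add: t_def)
    finally show ?thesis .
  qed
  have P_Q: "P (Qe * x) = 0" if x: "x \<in> X 1" for x
  proof -
    define t where "t k = \<alpha> k *s (Qe ^ Suc k * (L ^^ k) x)" for k
    have "\<alpha> k *s (Qe ^ k * (L ^^ k) (Qe * x)) = t k - (if k = 0 then 0 else t (k - 1))"
      if "k \<le> M" for k
    proof -
      have *: "(L ^^ k) (Qe * x) = Qe * (L ^^ k) x + (\<Sum>i<k. c (Suc i)) *s (L ^^ (k - 1)) x"
        using lap_power_Q[where X = X and Qe = Qe and L = L and c = c, OF L_X L_add L_scale comm x]
        by blast
      have "Qe ^ l * (Qe * y) = Qe * (Qe ^ l * y)" for l y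
        by (simp add: mult.assoc[symmetric] power_commutes)
      then show ?thesis
        unfolding * using that \<alpha>_Suc[of "k - 1"]
        by (cases k) (simp_all add: t_def distrib_left mult_scale_right scale_right_distrib
            mult.assoc del: sum.lessThan_Suc)
    qed
    then have "P (Qe * x) = (\<Sum>k=0..M. t k - (if k = 0 then 0 else t (k - 1)))"
      by (simp add: P_def)
    also have "\<dots> = t M"
      by (induction M) simp_all
    \<comment> \<open>Since \<open>x\<close> starts in \<open>X 1\<close>, already
      \<open>(L ^^ M) x\<close> lies in \<open>X (Suc M)\<close>.\<close>
    also have "\<dots> = 0"
      using pow_X[OF x, of M] X(2) by (simp add: t_def)
    finally show ?thesis .
  qed
  have P_id: "P u = u" if "L u = 0" for u
  proof -
    have "(L ^^ Suc k) u = 0" for k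
      by (induction k) (simp_all add: that L_zero)
    then have "(L ^^ k) u = 0" if "k > 0" for k
      using that by (metis gr0_conv_Suc)
    then have "(\<Sum>k=Suc 0..M. \<alpha> k *s (Qe ^ k * (L ^^ k) u)) = 0"
      by (intro sum.neutral) auto
    then show ?thesis
      by (simp add: P_def \<alpha>_0 sum.atLeast_Suc_atMost)
  qed
  have V_sub: "V \<subseteq> X 0"
    using Q_X by (auto simp: V_def)
  have split: "P p \<in> H \<and> p - P p \<in> V" if p: "p \<in> X 0" for p
  proof -
    \<comment> \<open>Every summand of \<open>P p\<close> beyond the first has a left factor
      \<open>Qe\<close>; its cofactor must lie in \<open>X 1\<close> for \<open>p - P p\<close> to
      be in \<open>V\<close>.\<close>
    have "Qe ^ k * (L ^^ Suc k) p \<in> X 1" for k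
      using Q_pow[of "(L ^^ Suc k) p" 1 k] pow_X[OF p, of "Suc k"] by simp
    then have sum_X: "(\<Sum>k<M. \<alpha> (Suc k) *s (Qe ^ k * (L ^^ Suc k) p)) \<in> X 1"
      by (intro subspace_sum[OF X(1)] subspace_scale[OF X(1)])
    have "P p = p + (\<Sum>k<M. \<alpha> (Suc k) *s (Qe ^ Suc k * (L ^^ Suc k) p))"
      unfolding P_def atLeast0AtMost lessThan_Suc_atMost[symmetric] sum.lessThan_Suc_shift
      by (simp add: \<alpha>_0)
    also have "\<dots> = p + Qe * (\<Sum>k<M. \<alpha> (Suc k) *s (Qe ^ k * (L ^^ Suc k) p))"
      by (simp add: sum_distrib_left mult_scale_right mult.assoc)
    finally have "p - P p = Qe * (- (\<Sum>k<M. \<alpha> (Suc k) *s (Qe ^ k * (L ^^ Suc k) p)))"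
      by simp
    then have V: "p - P p \<in> V"
      using subspace_neg[OF X(1) sum_X] unfolding V_def by blast
    then have "P p \<in> X 0"
      using subspace_diff[OF X(1) p, of "p - P p"] V_sub by auto
    then show ?thesis
      using P_harm[OF p] V by (simp add: H_def)
  qed
  have P_uv: "P (u + v) = u" if "u \<in> H" "v \<in> V" for u v
    using that P_id[of u] P_Q by (auto simp: P_add H_def V_def)
  show "direct_sum (X 0) H V"
    unfolding direct_sum_def
  proof
    have "p \<in> {u + v | u v. u \<in> H \<and> v \<in> V}" if "p \<in> X 0" for p
      using split[OF that] by (intro CollectI exI[of _ "P p"] exI[of _ "p - P p"]) simp
    moreover have "u + v \<in> X 0" if "u \<in> H" "v \<in> V" for u v
      using that V_sub by (intro subspace_add[OF X(1)]) (auto simp: H_def)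
    ultimately show "X 0 = {u + v | u v. u \<in> H \<and> v \<in> V}"
      by blast
    have zero: "0 \<in> H" "0 \<in> V"
      using subspace_0[OF X(1), of 0] subspace_0[OF X(1), of 1]
      by (auto simp: H_def V_def L_zero intro!: exI[of _ 0])
    \<comment> \<open>Such a \<open>v\<close> is fixed by \<open>P\<close> as an element of
      \<open>H\<close> and killed as an element of \<open>V\<close>.\<close>
    have "v = 0" if "v \<in> H" "v \<in> V" for v
      using P_uv[OF that(1) zero(2)] P_uv[OF zero(1) that(2)] by simp
    then show "H \<inter> V = {0}"
      using zero by blast
  qed
  show "projector H V p = (\<Sum>k=0..M. \<alpha> k *s (Qe ^ k * (L ^^ k) p))" if "p \<in> X 0"
    unfolding projector_def P_def[symmetric]
  proof (rule the_equality)
    show "P p \<in> H \<and> (\<exists>v\<in>V. p = P p + v)"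
      using split[OF that] by (auto intro!: bexI[of _ "p - P p"])
  qed (use P_uv in auto)
qed

end

section \<open>q-number identities for the coefficients \<open>alpha\<close>\<close>

lemma qnum_nonzero:
  assumes "q \<noteq> 0" "\<forall>k::nat. k > 0 \<longrightarrow> q ^ k \<noteq> 1" "a > 0"
  shows "qnum q a \<noteq> 0"
proof -
  obtain k where k: "a = int k" "k > 0"
    using assms(3) by (metis zero_less_imp_eq_int)
  have "q ^ (k + k) \<noteq> 1" "q ^ 2 \<noteq> 1"
    using assms k by auto
  then show ?thesis
    using assms(1) unfolding k qnum_of_nat
    by (simp add: power_add power_inverse power2_eq_square field_simps)
qed

lemma qnum_inverse [simp]: "qnum (inverse q) a = qnum q a"
proof -
  have "qnum (inverse q) a = - (q powi a - q powi (- a)) / - (q - inverse q)"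
    by (simp add: qnum_def power_int_minus power_int_inverse)
  then show ?thesis
    unfolding qnum_def by (simp only: minus_divide_divide)
qed

text \<open>Merges the two scalars that arise in \<open>laplace_Q_nat\<close>, from the Euler
  identity and from the weighted sum; \<open>Suc n\<close> is the number of variables.\<close>

lemma qnum_add_split:
  assumes "q \<noteq> 0" "q\<^sup>2 \<noteq> 1"
  shows "inverse q ^ Suc m * qnum q (int k) + q ^ k * (q ^ n * qnum q (int (m + Suc n))) =
    q ^ n * qnum q (int (m + k + Suc n))"
proof -
  define M K N where "M = q ^ m" and "K = q ^ k" and "N = q ^ n"
  have nz: "M \<noteq> 0" "K \<noteq> 0" "N \<noteq> 0"
    using assms by (simp_all add: M_def K_def N_def)
  have "inverse (q * M) * (K - inverse K) + K * (N * (M * N * q - inverse (M * N * q))) =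
      N * (M * K * N * q - inverse (M * K * N * q))"
    using assms nz by (simp add: field_simps)
  then have "(inverse (q * M) * (K - inverse K) + K * (N * (M * N * q - inverse (M * N * q))))
      / (q - inverse q) = N * (M * K * N * q - inverse (M * K * N * q)) / (q - inverse q)"
    by (rule arg_cong)
  then show ?thesis
    unfolding qnum_of_nat
    by (simp add: M_def K_def N_def power_add power_inverse add_divide_distrib mult_ac)
qed

text \<open>The source of the q-factorials in \<open>alpha\<close>: the accumulated commutation
  constants factor into two q-numbers. The induction step is an identity of rational functions in
  \<open>q\<close>, \<open>A\<close> and \<open>B\<close>.\<close>

lemma sum_qnum:
  assumes "q \<noteq> 0" "q\<^sup>2 \<noteq> 1"
  shows "(\<Sum>i<k. qnum q (N - 2 * int (Suc i))) = qnum q (int k) * qnum q (N - int k - 1)"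
proof (induction k)
  case (Suc k)
  define A B where "A = q ^ k" and "B = q powi N"
  have AB: "A \<noteq> 0" "B \<noteq> 0"
    using assms by (simp_all add: A_def B_def)
  have d: "q - inverse q \<noteq> 0"
    using assms by (auto simp: power2_eq_square field_simps)
  have "qnum q (int k) = (A - inverse A) / (q - inverse q)"
    "qnum q (int (Suc k)) = (A * q - inverse (A * q)) / (q - inverse q)"
    "qnum q (N - int k - 1) = (B / (A * q) - A * q / B) / (q - inverse q)"
    "qnum q (N - int (Suc k) - 1) = (B / (A * q\<^sup>2) - A * q\<^sup>2 / B) / (q - inverse q)"
    "qnum q (N - 2 * int (Suc k)) = (B / (A\<^sup>2 * q\<^sup>2) - A\<^sup>2 * q\<^sup>2 / B) / (q - inverse q)"
    using assms AB
    by (simp_all add: qnum_def A_def[symmetric] B_def[symmetric] power_int_diff power_int_add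
        power_int_minus power_int_mult field_simps power2_eq_square)
  note q = this
  have "(\<Sum>i<Suc k. qnum q (N - 2 * int (Suc i))) =
      qnum q (int k) * qnum q (N - int k - 1) + qnum q (N - 2 * int (Suc k))"
    by (simp only: sum.lessThan_Suc Suc.IH)
  also have "\<dots> = ((A - inverse A) * (B / (A * q) - A * q / B)
      + (q - inverse q) * (B / (A\<^sup>2 * q\<^sup>2) - A\<^sup>2 * q\<^sup>2 / B)) / (q - inverse q)\<^sup>2"
    unfolding q using d by (simp add: add_divide_distrib power2_eq_square)
  also have "(A - inverse A) * (B / (A * q) - A * q / B)
      + (q - inverse q) * (B / (A\<^sup>2 * q\<^sup>2) - A\<^sup>2 * q\<^sup>2 / B) =
      (A * q - inverse (A * q)) * (B / (A * q\<^sup>2) - A * q\<^sup>2 / B)"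
    using assms AB by (simp add: field_simps power2_eq_square)
  finally show ?case
    unfolding q by (simp add: power2_eq_square)
qed simp

lemma alpha_Suc:
  assumes "q \<noteq> 0" "\<forall>k::nat. k > 0 \<longrightarrow> q ^ k \<noteq> 1" "k < min m m'" "n > 0"
  shows "alpha q n m m' (Suc k) * (q ^ (n - 1) *
      (qnum q (int (Suc k)) * qnum q (int m + int m' + int n - int (Suc k) - 1))) =
    - alpha q n m m' k"
proof -
  define N where "N = int m + int m' + int n - 2"
  \<comment> \<open>\<open>k < min m m'\<close> and \<open>n > 0\<close> give
    \<open>N - k \<ge> k + 1\<close>, so both q-numbers have a positive argument; for
    \<open>N = -1\<close> there is no such \<open>k\<close>.\<close>
  have nz: "qnum q (int (Suc k)) \<noteq> 0" "qnum q (N - int k) \<noteq> 0"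
    using assms(3,4) by (intro qnum_nonzero[OF assms(1,2)]; simp add: N_def)+
  have powi: "q powi (- ((int n - 1) * int (Suc k))) * q ^ (n - 1) = q powi (- ((int n - 1) * int k))"
  proof -
    have "q ^ (n - 1) = q powi (int n - 1)"
      using assms(4) by (simp add: of_nat_diff power_int_def nat_diff_distrib)
    then show ?thesis
      using assms(1) by (simp add: power_int_add[symmetric] algebra_simps)
  qed
  have Suc: "qfact q (Suc k) = qfact q k * qnum q (int (Suc k))"
    "qfact_quot q N (Suc k) = qfact_quot q N k / qnum q (N - int k)"
    by (simp_all add: qfact_def qfact_quot_def)
  have "alpha q n m m' (Suc k) * (q ^ (n - 1) * (qnum q (int (Suc k)) * qnum q (N - int k))) =
      - ((-1) ^ k * (q powi (- ((int n - 1) * int (Suc k))) * q ^ (n - 1))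
        * (qfact_quot q N k / qfact q k))"
    unfolding alpha_def N_def[symmetric] Suc using nz by simp
  also have "\<dots> = - alpha q n m m' k"
    unfolding powi alpha_def N_def ..
  finally show ?thesis
    by (simp add: N_def algebra_simps)
qed

section \<open>The presented algebra\<close>

lemma free_alg_eq_sum_single:
  "p = (\<Sum>u\<in>Poly_Mapping.keys p. Poly_Mapping.single u (Poly_Mapping.lookup p u))"
proof (rule poly_mapping_eqI)
  fix v
  have "(\<Sum>u\<in>Poly_Mapping.keys p. Poly_Mapping.lookup p u when u = v) = Poly_Mapping.lookup p v"
    by (simp add: when_def in_keys_iff)
  then show "Poly_Mapping.lookup p v = Poly_Mapping.lookup
    (\<Sum>u\<in>Poly_Mapping.keys p. Poly_Mapping.single u (Poly_Mapping.lookup p u)) v"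
    by (simp add: lookup_sum lookup_single)
qed

lemma const_commute: "const c * p = p * const c" for p :: "'n free_alg"
proof -
  have "const c * Poly_Mapping.single u d = Poly_Mapping.single u d * const c" for u :: "'n word" and d
    by (simp add: const_def mult_single mult.commute)
  then show ?thesis
    by (subst (1 2) free_alg_eq_sum_single[of p]) (simp add: sum_distrib_left sum_distrib_right)
qed

lemma single_word_Cons:
  "Poly_Mapping.single (Word (g # gs)) (1 :: complex) = letter g * Poly_Mapping.single (Word gs) 1"
  by (simp add: letter_def mult_single plus_word_def)

section \<open>The presented algebra, its relations and the weights\<close>

locale q_algebra =
  fixes q :: complex
    and \<pi> :: "('n :: {finite, linorder}) free_alg \<Rightarrow> 'a :: ring_1"
    and D Dbar :: "'n \<Rightarrow> 'a \<Rightarrow> 'a"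
  assumes q_nonzero: "q \<noteq> 0"
    and q_not_root_of_unity: "\<forall>k::nat. k > 0 \<longrightarrow> q ^ k \<noteq> 1"
    and presents: "presents_algebra q \<pi>"
    and D: "q_partials q \<pi> D"
    and Dbar: "q_conj_partials q \<pi> Dbar"
begin

abbreviation "z i \<equiv> \<pi> (fz i)"
abbreviation "w i \<equiv> \<pi> (fw i)"

lemma q_square: "q\<^sup>2 \<noteq> 1"
  using q_not_root_of_unity by simp

lemma pi_add: "\<pi> (x + y) = \<pi> x + \<pi> y"
  and pi_mult: "\<pi> (x * y) = \<pi> x * \<pi> y"
  and pi_one: "\<pi> 1 = 1"
  and pi_surj: "surj \<pi>"
  and pi_relator: "x \<in> relators q \<Longrightarrow> \<pi> x = 0"
  using presents two_sided_ideal.base[of _ "relators q"]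
  unfolding presents_algebra_def by blast+

lemma pi_zero: "\<pi> 0 = 0"
  using pi_add[of 0 0] by simp

lemma pi_sum: "\<pi> (sum f I) = (\<Sum>i\<in>I. \<pi> (f i))"
  by (induction I rule: infinite_finite_induct) (simp_all add: pi_zero pi_add)

lemma pi_diff: "\<pi> (x - y) = \<pi> x - \<pi> y"
  using pi_add[of "x - y" y] by (simp add: eq_diff_eq)

sublocale complex_algebra "scal \<pi>"
proof
  fix c d x y
  show "scal \<pi> c (x + y) = scal \<pi> c x + scal \<pi> c y"
    by (simp add: scal_def distrib_left)
  show "scal \<pi> (c + d) x = scal \<pi> c x + scal \<pi> d x"
    by (simp add: scal_def const_def single_add pi_add distrib_right)
  show "scal \<pi> c (scal \<pi> d x) = scal \<pi> (c * d) x"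
    by (simp add: scal_def const_def mult_single pi_mult[symmetric] mult.assoc[symmetric])
  show "scal \<pi> 1 x = x"
    by (simp add: scal_def const_def pi_one)
  show "scal \<pi> c x * y = scal \<pi> c (x * y)"
    by (simp add: scal_def mult.assoc)
  obtain t where "x = \<pi> t"
    using pi_surj by (meson surjD)
  then show "x * scal \<pi> c y = scal \<pi> c (x * y)"
    by (simp add: scal_def mult.assoc[symmetric] pi_mult[symmetric] const_commute)
qed

lemma z_z: "i < j \<Longrightarrow> z i * z j = scal \<pi> q (z j * z i)"
proof -
  assume "i < j"
  then have "fz i * fz j - const q * fz j * fz i \<in> relators q"
    unfolding relators_def by blast
  from pi_relator[OF this] show ?thesis
    by (simp add: pi_diff pi_mult scal_def mult.assoc)
qed

lemma w_w: "i < j \<Longrightarrow> w i * w j = scal \<pi> (inverse q) (w j * w i)"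
proof -
  assume "i < j"
  then have "fw i * fw j - const (inverse q) * fw j * fw i \<in> relators q"
    unfolding relators_def by blast
  from pi_relator[OF this] show ?thesis
    by (simp add: pi_diff pi_mult scal_def mult.assoc)
qed

lemma w_z: "i \<noteq> j \<Longrightarrow> w j * z i = scal \<pi> q (z i * w j)"
proof -
  assume "i \<noteq> j"
  then have "fw j * fz i - const q * fz i * fw j \<in> relators q"
    unfolding relators_def by blast
  from pi_relator[OF this] show ?thesis
    by (simp add: pi_diff pi_mult scal_def mult.assoc)
qed

lemma w_z_same: "w k * z k = z k * w k + scal \<pi> (1 - q\<^sup>2) (\<Sum>s | s < k. z s * w s)"
proof -
  have "fw k * fz k - (fz k * fw k + const (1 - q\<^sup>2) * (\<Sum>s | s < k. fz s * fw s)) \<in> relators q"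
    unfolding relators_def by blast
  from pi_relator[OF this] show ?thesis
    by (simp add: pi_diff pi_add pi_sum pi_mult scal_def)
qed

text \<open>\<open>q ^ (2 (n - i))\<close> for \<open>i \<in> {1, \<dots>, n}\<close>.\<close>

definition weight :: "'n \<Rightarrow> complex" where
  "weight i = (q\<^sup>2) ^ card {k. i < k}"

abbreviation "z' i \<equiv> scal \<pi> (weight i) (z i)"

lemma weight_nonzero: "weight i \<noteq> 0"
  using q_nonzero by (simp add: weight_def)

text \<open>The elements above a member of \<open>U\<close> all lie in \<open>U\<close>, so the
  exponents are those of a full geometric series over \<open>U\<close>.\<close>

lemma sum_weight_up_closed:
  assumes "\<And>i k. i \<in> U \<Longrightarrow> i < k \<Longrightarrow> k \<in> U"
  shows "(q\<^sup>2 - 1) * sum weight U = (q\<^sup>2) ^ card U - 1"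
proof -
  have "sum weight U = (\<Sum>i\<in>U. (q\<^sup>2) ^ card {k \<in> U. i < k})"
    unfolding weight_def using assms
    by (intro sum.cong refl arg_cong[of _ _ "\<lambda>A. (q\<^sup>2) ^ card A"]) auto
  then show ?thesis
    using geometric_sum_linorder[of U "q\<^sup>2"] by simp
qed

text \<open>Moving each \<open>w s\<close> past \<open>z s\<close> gives \<open>z t * w t\<close> a
  coefficient that the geometric sums make independent of \<open>t\<close>. With
  \<open>S = UNIV\<close> this shows that the substitution fixes \<open>Q\<close>; with
  \<open>S = {s. s < k}\<close> it yields the conjugate of \<open>w_z_same\<close>.\<close>

lemma sum_w_z:
  assumes "\<And>i k. k \<in> S \<Longrightarrow> i < k \<Longrightarrow> i \<in> S"
  shows "(\<Sum>s\<in>S. scal \<pi> (weight s) (w s * z s)) =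
    scal \<pi> ((q\<^sup>2) ^ card (- S)) (\<Sum>s\<in>S. z s * w s)"
proof -
  have coeff: "weight t + (1 - q\<^sup>2) * (\<Sum>s | s \<in> S \<and> t < s. weight s) = (q\<^sup>2) ^ card (- S)"
    if "t \<in> S" for t
  proof -
    \<comment> \<open>As \<open>S\<close> is closed downwards, its complement lies entirely above
      \<open>t\<close>.\<close>
    have "{s. t < s} = {s. s \<in> S \<and> t < s} \<union> - S"
      using assms that by (force simp: not_less le_less)
    then have "sum weight {s. t < s} = (\<Sum>s | s \<in> S \<and> t < s. weight s) + sum weight (- S)"
      by (simp add: sum.union_disjoint disjoint_iff)
    moreover have "(q\<^sup>2 - 1) * sum weight {s. t < s} = weight t - 1"
      unfolding weight_def[of t] by (rule sum_weight_up_closed) auto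
    moreover have "(q\<^sup>2 - 1) * sum weight (- S) = (q\<^sup>2) ^ card (- S) - 1"
      by (rule sum_weight_up_closed) (use assms in auto)
    ultimately have "(q\<^sup>2 - 1) * (\<Sum>s | s \<in> S \<and> t < s. weight s) =
        weight t - (q\<^sup>2) ^ card (- S)"
      by (simp add: distrib_left eq_diff_eq)
    then show ?thesis
      using minus_diff_eq[of "q\<^sup>2" 1] by (metis diff_add_cancel diff_minus_eq_add minus_mult_left uminus_add_conv_diff minus_diff_eq)
  qed
  have "(\<Sum>s\<in>S. \<Sum>t | t < s. scal \<pi> (weight s) (z t * w t)) =
      (\<Sum>s\<in>S. \<Sum>t | t \<in> S \<and> t < s. scal \<pi> (weight s) (z t * w t))"
    using assms by (intro sum.cong refl) auto
  also have "\<dots> = (\<Sum>t\<in>S. \<Sum>s | s \<in> S \<and> t < s. scal \<pi> (weight s) (z t * w t))"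
    by (rule sum.swap_restrict) simp_all
  finally have swap: "(\<Sum>s\<in>S. scal \<pi> (weight s) (\<Sum>t | t < s. z t * w t)) =
      (\<Sum>t\<in>S. scal \<pi> (\<Sum>s | s \<in> S \<and> t < s. weight s) (z t * w t))"
    by (simp add: scale_sum_right scale_sum_left)
  have "(\<Sum>s\<in>S. scal \<pi> (weight s) (w s * z s)) = (\<Sum>s\<in>S. scal \<pi> (weight s) (z s * w s))
      + scal \<pi> (1 - q\<^sup>2) (\<Sum>s\<in>S. scal \<pi> (weight s) (\<Sum>t | t < s. z t * w t))"
    unfolding w_z_same
    by (simp add: scale_right_distrib sum.distrib scale_sum_right mult.commute)
  also have "\<dots> = (\<Sum>t\<in>S. scal \<pi> (weight t + (1 - q\<^sup>2) * (\<Sum>s | s \<in> S \<and> t < s. weight s)) (z t * w t))"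
    unfolding swap by (simp add: scale_left_distrib sum.distrib scale_sum_right)
  also have "\<dots> = scal \<pi> ((q\<^sup>2) ^ card (- S)) (\<Sum>s\<in>S. z s * w s)"
    by (simp add: coeff scale_sum_right)
  finally show ?thesis .
qed

section \<open>The two interpretations of the calculus\<close>

lemma zmon_eq: "zmon \<pi> r = ordmon z r" and wmon_eq: "wmon \<pi> r = ordmon w r"
  by (simp_all add: zmon_def wmon_def ordmon_def)

text \<open>Carries a formula from ordered right factors, on which the operators are defined, to all
  right factors of degree \<open>k\<close>, as the locale assumption \<open>D_ordmon\<close>
  demands.\<close>

lemma linear_eq_on_left_span:
  assumes "q_commuting (scal \<pi>) a p" "u \<in> left_span a {1} k"
    and "Vector_Spaces.linear (scal \<pi>) (scal \<pi>) f"
    and "\<And>r. f (x * ordmon a r) = scal \<pi> c (y * ordmon a r)"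
  shows "f (x * u) = scal \<pi> c (y * u)"
proof -
  interpret q_commuting "scal \<pi>" a p
    by fact
  have f: "f (s + t) = f s + f t" "f (scal \<pi> d s) = scal \<pi> d (f s)" for s t d
    using assms(3) by (auto simp: Vector_Spaces.linear_iff)
  have f0: "f 0 = 0"
    using f(2)[of 0 0] by simp
  have "u \<in> span {ordmon a r * v | r v. (\<Sum>i\<in>UNIV. r i) = k \<and> v \<in> {1}}"
    using left_span_subset_span_ordmon assms(2) by blast
  then show ?thesis
    by (rule span_induct) (auto simp: assms(4) f f0 distrib_left mult_scale_right
        scale_right_distrib mult.commute intro!: subspaceI)
qed

lemma q_commuting_z: "q_commuting (scal \<pi>) z q"
  by standard (simp_all add: q_nonzero z_z)

lemma q_commuting_w: "q_commuting (scal \<pi>) w (inverse q)"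
  by standard (simp_all add: q_nonzero w_w)

lemma left_span_z': "u \<in> left_span z' U k \<Longrightarrow> u \<in> left_span z U k"
  by (induction rule: left_span_induct) (auto simp: scale_mult_left intro: left_span_intros)

lemma partial_linear: "Vector_Spaces.linear (scal \<pi>) (scal \<pi>) (D i)"
  and partial_monomial: "D i (ordmon z r * ordmon w s) =
    scal \<pi> (q ^ (\<Sum>j | i < j. r j) * qnum q (int (r i))) (ordmon z (r(i := r i - 1)) * ordmon w s)"
  using D unfolding q_partials_def zmon_eq wmon_eq by blast+

lemma conj_partial_linear: "Vector_Spaces.linear (scal \<pi>) (scal \<pi>) (Dbar i)"
  and conj_partial_monomial: "Dbar i (ordmon w r * ordmon z s) =
    scal \<pi> (inverse q ^ (\<Sum>j | i < j. r j) * qnum q (int (r i)))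
      (ordmon w (r(i := r i - 1)) * ordmon z s)"
proof -
  have powi: "q powi (- int k) = inverse q ^ k" for k
    by (simp add: power_int_minus power_inverse)
  show "Vector_Spaces.linear (scal \<pi>) (scal \<pi>) (Dbar i)"
    and "Dbar i (ordmon w r * ordmon z s) =
      scal \<pi> (inverse q ^ (\<Sum>j | i < j. r j) * qnum q (int (r i)))
        (ordmon w (r(i := r i - 1)) * ordmon z s)"
    using Dbar unfolding q_conj_partials_def zmon_eq wmon_eq powi by blast+
qed

sublocale zw: q_derivations "scal \<pi>" z q w D
proof (intro q_derivations.intro q_derivations_axioms.intro q_commuting_z)
  show "q\<^sup>2 \<noteq> 1"
    by (rule q_square)
  show "w j * z i = scal \<pi> q (z i * w j)" if "i \<noteq> j" for i j
    using that by (rule w_z)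
  show "w k * z k = z k * w k + scal \<pi> (1 - q\<^sup>2) (\<Sum>s | s < k. z s * w s)" for k
    by (rule w_z_same)
  show "Vector_Spaces.linear (scal \<pi>) (scal \<pi>) (D i)" for i
    by (rule partial_linear)
next
  fix u l i r
  assume u: "u \<in> left_span w {1} l"
  show "D i (ordmon z r * u) = scal \<pi> (q ^ (\<Sum>j | i < j. r j) * qnum q (int (r i)))
      (ordmon z (r(i := r i - 1)) * u)"
    by (rule linear_eq_on_left_span[OF q_commuting_w u partial_linear partial_monomial])
qed

text \<open>The conjugate instance; the weights in \<open>z'\<close> are what makes
  \<open>b_a_same\<close> hold with \<open>inverse q\<close>.\<close>

sublocale wz: q_derivations "scal \<pi>" w "inverse q" z' Dbar
proof (intro q_derivations.intro q_derivations_axioms.intro q_commuting_w)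
  show "(inverse q)\<^sup>2 \<noteq> 1"
    using q_square by (simp add: power_inverse)
next
  fix i j :: 'n
  assume "i \<noteq> j"
  then show "z' j * w i = scal \<pi> (inverse q) (w i * z' j)"
    using w_z[of j i] q_nonzero by (simp add: scale_mult_left mult_scale_right)
next
  fix k :: 'n
  \<comment> \<open>The exponent in \<open>sum_w_z\<close> counts \<open>k\<close> itself as well,
    hence the extra \<open>q\<^sup>2\<close>, which turns \<open>1 - (inverse q)\<^sup>2\<close>
    into \<open>- (1 - q\<^sup>2)\<close>.\<close>
  have "- {s. s < k} = insert k {s. k < s}"
    by (auto simp: not_less le_less)
  then have "(q\<^sup>2) ^ card (- {s. s < k}) = q\<^sup>2 * weight k"
    by (simp add: weight_def)
  then have "(\<Sum>s | s < k. w s * z' s) = scal \<pi> (q\<^sup>2 * weight k) (\<Sum>s | s < k. z s * w s)"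
    using sum_w_z[of "{s. s < k}"] by (simp add: mult_scale_right)
  moreover have "(1 - (inverse q)\<^sup>2) * (q\<^sup>2 * weight k) = - (weight k * (1 - q\<^sup>2))"
    using q_nonzero by (simp add: algebra_simps power_inverse)
  ultimately show "z' k * w k = w k * z' k
      + scal \<pi> (1 - (inverse q)\<^sup>2) (\<Sum>s | s < k. w s * z' s)"
    by (simp add: scale_mult_left mult_scale_right w_z_same scale_right_distrib)
next
  show "Vector_Spaces.linear (scal \<pi>) (scal \<pi>) (Dbar i)" for i
    by (rule conj_partial_linear)
next
  fix u l i r
  assume "u \<in> left_span z' {1} l"
  then have u: "u \<in> left_span z {1} l"
    by (rule left_span_z')
  show "Dbar i (ordmon w r * u) =
      scal \<pi> (inverse q ^ (\<Sum>j | i < j. r j) * qnum (inverse q) (int (r i)))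
      (ordmon w (r(i := r i - 1)) * u)"
    unfolding qnum_inverse
    by (rule linear_eq_on_left_span[OF q_commuting_z u conj_partial_linear conj_partial_monomial])
qed

section \<open>The bigrading\<close>

lemma zdeg_add: "zdeg (u + v) = zdeg u + zdeg v"
  and wdeg_add: "wdeg (u + v) = wdeg u + wdeg v"
  by (simp_all add: zdeg_def wdeg_def plus_word_def)

lemma homog_mult: "x \<in> homog \<pi> a b \<Longrightarrow> y \<in> homog \<pi> c d \<Longrightarrow> x * y \<in> homog \<pi> (a + c) (b + d)"
proof -
  assume "x \<in> homog \<pi> a b" "y \<in> homog \<pi> c d"
  then obtain s t where st: "x = \<pi> s" "y = \<pi> t"
    "\<And>u. u \<in> Poly_Mapping.keys s \<Longrightarrow> int (zdeg u) = a \<and> int (wdeg u) = b"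
    "\<And>u. u \<in> Poly_Mapping.keys t \<Longrightarrow> int (zdeg u) = c \<and> int (wdeg u) = d"
    unfolding homog_def by blast
  have "int (zdeg u) = a + c \<and> int (wdeg u) = b + d" if u: "u \<in> Poly_Mapping.keys (s * t)" for u
  proof -
    obtain v v' where "u = v + v'" "v \<in> Poly_Mapping.keys s" "v' \<in> Poly_Mapping.keys t"
      using u keys_mult[of s t] by blast
    then show ?thesis
      using st by (simp add: zdeg_add wdeg_add)
  qed
  then show ?thesis
    unfolding st pi_mult[symmetric] homog_def by blast
qed

lemma z_homog: "z i \<in> homog \<pi> 1 0"
  and w_homog: "w i \<in> homog \<pi> 0 1"
  and const_homog: "\<pi> (const c) \<in> homog \<pi> 0 0"
  unfolding homog_def
  by (rule imageI, simp add: letter_def const_def zdeg_def wdeg_def zero_word_def)+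

lemma subspace_homog: "subspace (homog \<pi> a b)"
proof (rule subspaceI)
  show "0 \<in> homog \<pi> a b"
    unfolding homog_def by (rule image_eqI[of _ _ 0]) (simp_all add: pi_zero)
  show "x + y \<in> homog \<pi> a b" if xy: "x \<in> homog \<pi> a b" "y \<in> homog \<pi> a b" for x y
  proof -
    obtain s t where st: "x = \<pi> s" "y = \<pi> t"
      "\<forall>u \<in> Poly_Mapping.keys s \<union> Poly_Mapping.keys t. int (zdeg u) = a \<and> int (wdeg u) = b"
      using xy unfolding homog_def by blast
    then have "\<forall>u \<in> Poly_Mapping.keys (s + t). int (zdeg u) = a \<and> int (wdeg u) = b"
      using keys_add[of s t] by blast
    then show ?thesis
      unfolding st pi_add[symmetric] homog_def by blast
  qed
  show "scal \<pi> c x \<in> homog \<pi> a b" if "x \<in> homog \<pi> a b" for c x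
    using homog_mult[OF const_homog that] by (simp add: scal_def)
qed

lemma homog_neg: "a < 0 \<or> b < 0 \<Longrightarrow> homog \<pi> a b = {0}"
proof -
  assume "a < 0 \<or> b < 0"
  then have "{p :: 'n free_alg. \<forall>u \<in> Poly_Mapping.keys p. int (zdeg u) = a \<and> int (wdeg u) = b} = {0}"
    using keys_eq_empty by fastforce
  then show ?thesis
    unfolding homog_def by (simp add: pi_zero)
qed

text \<open>Every word arises from the empty one by putting letters on the left, so each component
  is contained in any family of subspaces that respects both degrees.\<close>

lemma homog_subset:
  fixes F :: "nat \<Rightarrow> nat \<Rightarrow> 'a set"
  assumes F: "\<And>m k. subspace (F m k)" "1 \<in> F 0 0"
    "\<And>m k i x. x \<in> F m k \<Longrightarrow> z i * x \<in> F (Suc m) k"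
    "\<And>m k i x. x \<in> F m k \<Longrightarrow> w i * x \<in> F m (Suc k)"
  shows "homog \<pi> (int m) (int k) \<subseteq> F m k"
proof
  fix x
  assume "x \<in> homog \<pi> (int m) (int k)"
  then obtain p where p: "x = \<pi> p"
    "\<And>u. u \<in> Poly_Mapping.keys p \<Longrightarrow> zdeg u = m \<and> wdeg u = k"
    unfolding homog_def by auto
  have "\<pi> (Poly_Mapping.single (Word gs) 1) \<in> F (zdeg (Word gs)) (wdeg (Word gs))" for gs
  proof (induction gs)
    case Nil
    have "Poly_Mapping.single (Word [] :: 'n word) (1::complex) = 1"
      by (simp flip: zero_word_def)
    then show ?case
      using F(2) by (simp add: pi_one zdeg_def wdeg_def)
  next
    case (Cons g gs)
    then show ?case
      by (cases g) (auto simp: single_word_Cons pi_mult zdeg_def wdeg_def intro: F)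
  qed
  then have word: "\<pi> (Poly_Mapping.single u 1) \<in> F (zdeg u) (wdeg u)" for u
    by (metis word.collapse)
  have "Poly_Mapping.single u c = const c * Poly_Mapping.single u 1" for u :: "'n word" and c
    by (simp add: const_def mult_single)
  then have single: "\<pi> (Poly_Mapping.single u c) = scal \<pi> c (\<pi> (Poly_Mapping.single u 1))" for u c
    unfolding scal_def pi_mult[symmetric] by (rule arg_cong)
  have "x = (\<Sum>u\<in>Poly_Mapping.keys p.
      scal \<pi> (Poly_Mapping.lookup p u) (\<pi> (Poly_Mapping.single u 1)))"
    unfolding single[symmetric] pi_sum[symmetric] p(1) free_alg_eq_sum_single[symmetric] ..
  also have "\<dots> \<in> F m k"
    using p(2) word by (intro subspace_sum[OF F(1)] subspace_scale[OF F(1)]) metis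
  finally show "x \<in> F m k" .
qed

lemma left_span_homog:
  assumes "x \<in> left_span a U l" "\<And>i. a i \<in> homog \<pi> d e" "U \<subseteq> homog \<pi> m k"
  shows "x \<in> homog \<pi> (m + int l * d) (k + int l * e)"
  using assms(1)
proof (induction rule: left_span_induct)
  case (mult l x i)
  then show ?case
    using homog_mult[OF assms(2)[of i] mult.IH] by (simp add: algebra_simps)
qed (use assms in \<open>auto intro: subspace_homog[THEN subspace_0] subspace_homog[THEN subspace_add]
    subspace_homog[THEN subspace_scale]\<close>)

lemma one_homog: "1 \<in> homog \<pi> 0 0"
  using const_homog[of 1] by (simp add: const_def pi_one)

lemma zw_bihom: "zw.bihom m k = homog \<pi> (int m) (int k)"
proof
  have "left_span w {1} k \<subseteq> homog \<pi> 0 (int k)"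
    using left_span_homog[of _ w "{1}" k 0 1 0 0] w_homog one_homog by auto
  then show "zw.bihom m k \<subseteq> homog \<pi> (int m) (int k)"
    using left_span_homog[of _ z "left_span w {1} k" m 1 0 0 "int k"] z_homog by auto
  show "homog \<pi> (int m) (int k) \<subseteq> zw.bihom m k"
    by (rule homog_subset)
      (auto intro: subspace_left_span left_span_base left_span_mult zw.b_bihom)
qed

text \<open>The degrees change places because the \<open>w i\<close> now play the part of the
  \<open>a i\<close>. The weights are invertible, so closure under \<open>z' i\<close> gives closure
  under \<open>z i\<close>.\<close>

lemma wz_bihom: "wz.bihom k m = homog \<pi> (int m) (int k)"
proof
  have "left_span z' {1} m \<subseteq> homog \<pi> (int m) 0"
    using left_span_homog[of _ z' "{1}" m 1 0 0 0] one_homog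
      subspace_scale[OF subspace_homog z_homog] by auto
  then show "wz.bihom k m \<subseteq> homog \<pi> (int m) (int k)"
    using left_span_homog[of _ w "left_span z' {1} m" k 0 1 "int m" 0] w_homog by auto
  have "z i * x = scal \<pi> (inverse (weight i)) (z' i * x)" for i x
    by (simp add: scale_mult_left weight_nonzero)
  then have "z i * x \<in> wz.bihom l (Suc j)" if "x \<in> wz.bihom l j" for i x j l
    using wz.b_bihom[OF that] by (simp add: left_span_scale)
  then show "homog \<pi> (int m) (int k) \<subseteq> wz.bihom k m"
    by (intro homog_subset) (auto intro: subspace_left_span left_span_base left_span_mult)
qed

lemma zw_Q: "zw.Q = Qelt \<pi>"
  unfolding zw.Q_def Qelt_def ..

lemma wz_Q: "wz.Q = Qelt \<pi>"
  unfolding wz.Q_def Qelt_def mult_scale_right using sum_w_z[of UNIV] by simp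

section \<open>The q-Laplace operator and the projection\<close>

abbreviation "\<Delta> \<equiv> q_laplace D Dbar"

lemma laplace_add: "\<Delta> (x + y) = \<Delta> x + \<Delta> y"
  and laplace_scale: "\<Delta> (scal \<pi> c x) = scal \<pi> c (\<Delta> x)"
  unfolding q_laplace_def
  by (simp_all only: zw.D_add wz.D_add zw.D_scale wz.D_scale sum.distrib scale_sum_right)

lemma laplace_zero: "\<Delta> 0 = 0"
  by (simp add: q_laplace_def)

lemma Dbar_homog:
  assumes "x \<in> homog \<pi> (int m) (int k)"
  shows "Dbar i x \<in> (if k = 0 then {0} else homog \<pi> (int m) (int (k - 1)))"
  using wz.D_lower[where m = k and k = m, unfolded wz_bihom, OF assms] by simp

lemma D_homog:
  assumes "x \<in> homog \<pi> (int m) (int k)"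
  shows "D i x \<in> (if m = 0 then {0} else homog \<pi> (int (m - 1)) (int k))"
  using zw.D_lower[where m = m and k = k, unfolded zw_bihom, OF assms] by simp

lemma laplace_homog: "x \<in> homog \<pi> a b \<Longrightarrow> \<Delta> x \<in> homog \<pi> (a - 1) (b - 1)"
proof (cases "a < 0 \<or> b < 0")
  case True
  assume "x \<in> homog \<pi> a b"
  then show ?thesis
    using True homog_neg subspace_0[OF subspace_homog] by (simp add: laplace_zero)
next
  case False
  assume x: "x \<in> homog \<pi> a b"
  obtain m k where mk: "a = int m" "b = int k"
    using False by (metis not_less nonneg_int_cases)
  have "D i (Dbar i x) \<in> homog \<pi> (a - 1) (b - 1)" for i
  proof (cases "m = 0 \<or> k = 0")
    case True
    \<comment> \<open>For \<open>k = 0\<close> the truncated degree is harmless, because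
      \<open>Dbar i x\<close> is then \<open>0\<close>.\<close>
    have "Dbar i x \<in> homog \<pi> (int m) (int (k - 1))"
      using Dbar_homog[of x m k i] x mk subspace_0[OF subspace_homog] by (auto split: if_splits)
    then have "D i (Dbar i x) = 0"
      using True D_homog[of "Dbar i x" m "k - 1" i] Dbar_homog[of x m k i] x mk
      by (cases "k = 0") auto
    then show ?thesis
      by (simp add: subspace_0[OF subspace_homog])
  next
    case False
    then show ?thesis
      using D_homog[of "Dbar i x" m "k - 1" i] Dbar_homog[of x m k i] x mk
      by (simp add: of_nat_diff)
  qed
  then show ?thesis
    unfolding q_laplace_def by (intro subspace_sum[OF subspace_homog])
qed

lemma laplace_Q_nat:
  assumes "x \<in> homog \<pi> (int m) (int k)"
  shows "\<Delta> (Qelt \<pi> * x) = Qelt \<pi> * \<Delta> x +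
    scal \<pi> (q ^ (CARD('n) - 1) * qnum q (int m + int k + int CARD('n))) x"
proof -
  note x = assms[folded zw_bihom] assms[folded wz_bihom]
  \<comment> \<open>In the conjugate instance \<open>inverse p ^ k\<close> reads
    \<open>q ^ k\<close>, and \<open>weight i\<close> comes out of \<open>z' i\<close>.\<close>
  have Dbar_Q: "Dbar i (Qelt \<pi> * x) =
      scal \<pi> (inverse q) (Qelt \<pi> * Dbar i x) + scal \<pi> (q ^ k * weight i) (z i * x)" for i
    using wz.D_Q_mult[OF x(2), of i] by (simp add: wz_Q scale_mult_left)
  have D_Q: "D i (Qelt \<pi> * Dbar i x) =
      scal \<pi> q (Qelt \<pi> * D i (Dbar i x)) + scal \<pi> (inverse q ^ m) (w i * Dbar i x)" for i
  proof -
    have "Dbar i x \<in> zw.bihom m (k - 1)"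
      using Dbar_homog[OF assms, of i] subspace_0[OF subspace_homog] unfolding zw_bihom
      by (auto split: if_splits)
    then show ?thesis
      using zw.D_Q_mult by (simp add: zw_Q)
  qed
  \<comment> \<open>The factors \<open>q\<close> and \<open>inverse q\<close> of the two rules
    cancel, so \<open>Qelt \<pi> * D i (Dbar i x)\<close> has coefficient 1.\<close>
  have "D i (Dbar i (Qelt \<pi> * x)) = Qelt \<pi> * D i (Dbar i x)
      + scal \<pi> (inverse q ^ Suc m) (w i * Dbar i x)
      + scal \<pi> (q ^ k) (scal \<pi> (weight i) (D i (z i * x)))" for i
    using q_nonzero
    by (simp add: Dbar_Q D_Q zw.D_add zw.D_scale scale_right_distrib)
  then have "\<Delta> (Qelt \<pi> * x) = Qelt \<pi> * \<Delta> x
      + scal \<pi> (inverse q ^ Suc m) (\<Sum>i\<in>UNIV. w i * Dbar i x)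
      + scal \<pi> (q ^ k) (\<Sum>i\<in>UNIV. scal \<pi> (weight i) (D i (z i * x)))"
    by (simp only: q_laplace_def sum.distrib sum_distrib_left scale_sum_right)
  also have "(\<Sum>i\<in>UNIV. w i * Dbar i x) = scal \<pi> (qnum q (int k)) x"
    using wz.euler[OF x(2)] by (simp add: qnum_inverse)
  also have "(\<Sum>i\<in>UNIV. scal \<pi> (weight i) (D i (z i * x))) =
      scal \<pi> (q ^ (CARD('n) - 1) * qnum q (int (m + CARD('n)))) x"
    using zw.sum_D_a_mult[OF x(1)] by (simp add: weight_def)
  finally have "\<Delta> (Qelt \<pi> * x) = Qelt \<pi> * \<Delta> x + scal \<pi> (inverse q ^ Suc m * qnum q (int k)
      + q ^ k * (q ^ (CARD('n) - 1) * qnum q (int (m + CARD('n))))) x"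
    by (simp add: scale_left_distrib add.assoc)
  also have "inverse q ^ Suc m * qnum q (int k)
      + q ^ k * (q ^ (CARD('n) - 1) * qnum q (int (m + CARD('n)))) =
      q ^ (CARD('n) - 1) * qnum q (int m + int k + int CARD('n))"
    using qnum_add_split[OF q_nonzero q_square, of m k "CARD('n) - 1"]
    by simp
  finally show ?thesis .
qed

lemma laplace_Q:
  assumes "x \<in> homog \<pi> a b"
  shows "\<Delta> (Qelt \<pi> * x) = Qelt \<pi> * \<Delta> x +
    scal \<pi> (q ^ (CARD('n) - 1) * qnum q (a + b + int CARD('n))) x"
proof (cases "a < 0 \<or> b < 0")
  case True
  then show ?thesis
    using assms homog_neg by (simp add: laplace_zero)
next
  case False
  then show ?thesis
    using assms laplace_Q_nat by (metis not_less nonneg_int_cases)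
qed

lemma Q_homog_mem: "x \<in> homog \<pi> a b \<Longrightarrow> Qelt \<pi> * x \<in> homog \<pi> (a + 1) (b + 1)"
proof -
  assume x: "x \<in> homog \<pi> a b"
  have "Qelt \<pi> \<in> homog \<pi> 1 1"
    unfolding Qelt_def using homog_mult[OF z_homog w_homog]
    by (intro subspace_sum[OF subspace_homog]) simp
  from homog_mult[OF this x] show ?thesis
    by (simp add: add.commute)
qed

theorem harmonic_projection:
  fixes m m' :: nat
  shows "direct_sum (homog \<pi> m m') (harmonic_homog \<pi> \<Delta> m m') (Q_homog \<pi> m m')"
    and "p \<in> homog \<pi> m m' \<Longrightarrow>
      projector (harmonic_homog \<pi> \<Delta> m m') (Q_homog \<pi> m m') p =
        (\<Sum>k = 0..min m m'. scal \<pi> (alpha q CARD('n) m m' k) (Qelt \<pi> ^ k * (\<Delta> ^^ k) p))"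
proof -
  \<comment> \<open>\<open>X j\<close> has the bidegree left after \<open>j\<close> applications of
    \<open>\<Delta>\<close>, and \<open>c j\<close> is the constant of \<open>laplace_Q\<close>
    there, with the total degree lowered by \<open>2 * j\<close>.\<close>
  define X where "X j = homog \<pi> (int m - int j) (int m' - int j)" for j
  define c where "c j = q ^ (CARD('n) - 1) * qnum q (int m + int m' + int CARD('n) - 2 * int j)" for j
  have sum_c: "(\<Sum>i<k. c (Suc i)) = q ^ (CARD('n) - 1) * (qnum q (int k)
      * qnum q (int m + int m' + int CARD('n) - int k - 1))" for k
    unfolding c_def sum_distrib_left[symmetric] using sum_qnum[OF q_nonzero q_square] by simp
  have X: "subspace (X j)" for j
    by (simp add: X_def subspace_homog)
  \<comment> \<open>Here at least one of the two degrees is \<open>-1\<close>.\<close>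
  have X_M: "X (Suc (min m m')) = {0}"
    unfolding X_def by (rule homog_neg) auto
  have Q_X: "Qelt \<pi> * x \<in> X j" if "x \<in> X (Suc j)" for j x
    using Q_homog_mem that unfolding X_def by fastforce
  have L_X: "\<Delta> x \<in> X (Suc j)" if "x \<in> X j" for j x
    using laplace_homog[OF that[unfolded X_def]] by (simp add: X_def algebra_simps)
  have comm: "\<Delta> (Qelt \<pi> * x) = Qelt \<pi> * \<Delta> x + scal \<pi> (c (Suc j)) x" if "x \<in> X (Suc j)" for j x
    using laplace_Q[OF that[unfolded X_def]] by (simp add: c_def algebra_simps)
  have \<alpha>_0: "alpha q CARD('n) m m' 0 = 1"
    by (simp add: alpha_def qfact_quot_def qfact_def)
  have \<alpha>_Suc: "alpha q CARD('n) m m' (Suc k) * (\<Sum>i<Suc k. c (Suc i)) = - alpha q CARD('n) m m' k"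
    if "k < min m m'" for k
    unfolding sum_c using alpha_Suc[OF q_nonzero q_not_root_of_unity that] by simp
  have eqs: "harmonic_homog \<pi> \<Delta> m m' = X 0 \<inter> {p. \<Delta> p = 0}"
    "Q_homog \<pi> m m' = {Qelt \<pi> * x | x. x \<in> X 1}" "homog \<pi> m m' = X 0"
    by (simp_all add: harmonic_homog_def harmonic_def Q_homog_def X_def)
  show "direct_sum (homog \<pi> m m') (harmonic_homog \<pi> \<Delta> m m') (Q_homog \<pi> m m')"
    unfolding eqs
    by (rule fischer_projector(1)[where X = X and M = "min m m'" and Qe = "Qelt \<pi>" and L = \<Delta>
        and c = c and \<alpha> = "alpha q CARD('n) m m'",
        OF X X_M Q_X L_X laplace_add laplace_scale comm \<alpha>_0 \<alpha>_Suc])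
  show "p \<in> homog \<pi> m m' \<Longrightarrow>
      projector (harmonic_homog \<pi> \<Delta> m m') (Q_homog \<pi> m m') p =
        (\<Sum>k = 0..min m m'. scal \<pi> (alpha q CARD('n) m m' k) (Qelt \<pi> ^ k * (\<Delta> ^^ k) p))"
    unfolding eqs
    by (rule fischer_projector(2)[where X = X and M = "min m m'" and Qe = "Qelt \<pi>" and L = \<Delta>
        and c = c and \<alpha> = "alpha q CARD('n) m m'",
        OF X X_M Q_X L_X laplace_add laplace_scale comm \<alpha>_0 \<alpha>_Suc])
qed

end

theorem mainTheorem2:
  fixes q :: complex
    and \<pi> :: "('n :: {finite, linorder}) free_alg \<Rightarrow> 'a :: ring_1"
    and D Dbar :: "'n \<Rightarrow> 'a \<Rightarrow> 'a"
    and m m' :: nat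
  assumes q_nonzero: "q \<noteq> 0"
    and q_not_root_of_unity: "\<forall>k::nat. k > 0 \<longrightarrow> q ^ k \<noteq> 1"
    and A: "presents_algebra q \<pi>"
    and D: "q_partials q \<pi> D"
    and Dbar: "q_conj_partials q \<pi> Dbar"
  shows "direct_sum (homog \<pi> m m') (harmonic_homog \<pi> (q_laplace D Dbar) m m') (Q_homog \<pi> m m')
    \<and> (\<forall>p \<in> homog \<pi> m m'.
         projector (harmonic_homog \<pi> (q_laplace D Dbar) m m') (Q_homog \<pi> m m') p =
           (\<Sum>k = 0..min m m'.
              scal \<pi> (alpha q CARD('n) m m' k) (Qelt \<pi> ^ k * (q_laplace D Dbar ^^ k) p)))"
proof -
  interpret q_algebra q \<pi> D Dbar
    by unfold_locales fact+
  show ?thesis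
    using harmonic_projection by blast
qed

end
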